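(* Let $X\in G$ and $Y,Z\in USS(X)$ with $\ell(Y)>0$. Then there is an oriented path $(g_1,\ldots,g_s,b_1,\ldots,b_t)$ in $\Gamma_X$ from $Y$ to $Z$ such that $(g_1,\ldots,g_s)$ is a (possibly empty) grey path and $(b_1,\ldots,b_t)$ is a (possibly empty) black path. Moreover, if $Z=Y^\alpha$ with $\alpha\in P$, the path can be chosen so that $g_1\cdots g_s b_1\cdots b_t=\alpha$.
   Context: $G$ is a Garside group: it has a lattice order $\preccurlyeq$ invariant under left multiplication ($a\preccurlyeq b$ iff $a^{-1}b\in P$, where $P=\{p\in G:1\preccurlyeq p\}$), with meet $\wedge$; there is a Garside element $\Delta\in P$ such that $[1,\Delta]$ is finite and generates $G$ and $\Delta^{-1}P\Delta=P$; and $P$ is atomic. Elements of $[1,\Delta]$ are simple. $\tau(x)=\Delta^{-1}x\Delta$; $X^a=a^{-1}Xa$. Left normal form $X=\Delta^p x_1\cdots x_r$: $p$ maximal with $\Delta^p\preccurlyeq X$, each $x_i\neq 1$ the maximal simple prefix of $x_i\cdots x_r$; $\inf X=p$, $\sup X=p+r$, $\ell(X)=r$. $\iota(X)=\tau^{-p}(x_1)$ if $r>0$, $\iota(\Delta^p)=1$. $\mathbf c(X)=X^{\iota(X)}$. $SSS(X)$: conjugates of $X$ of maximal infimum and minimal supremum; $USS(X)$: those $Y\in SSS(X)$ with $\mathbf c^m(Y)=Y$ for some $m>0$. A minimal simple element for $Y\in USS(X)$ is a simple $s\neq1$ with $Y^s\in USS(X)$ such that no prefix $t\ne1$, $t\neq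 s$ of $s$ has $Y^t\in USS(X)$. $\Gamma_X$ is the directed graph with vertex set $USS(X)$ and an arrow labeled $s$ from $Y$ to $Y^s$ for each $Y\in USS(X)$ and each minimal simple element $s$ for $Y$. An arrow $s$ starting at $Y$ is black if $s\preccurlyeq\iota(Y)$ and grey if $s\preccurlyeq\iota(Y^{-1})$. An oriented path is a sequence of arrows, each starting at the endpoint of the previous one; it is black (grey) if all its arrows are black (grey). *)

theory Defs
  imports "HOL-Algebra.Generated_Groups"
begin

definition gprod :: "('a, 'b) monoid_scheme \<Rightarrow> 'a list \<Rightarrow> 'a" where
  "gprod G xs = foldr (\<lambda>x y. x \<otimes>\<^bsub>G\<^esub> y) xs \<one>\<^bsub>G\<^esub>"

definition prefix_le :: "('a, 'b) monoid_scheme \<Rightarrow> 'a set \<Rightarrow> 'a \<Rightarrow> 'a \<Rightarrow> bool" where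
  "prefix_le G P a b \<longleftrightarrow> inv\<^bsub>G\<^esub> a \<otimes>\<^bsub>G\<^esub> b \<in> P"

definition is_glb :: "('a, 'b) monoid_scheme \<Rightarrow> 'a set \<Rightarrow> 'a \<Rightarrow> 'a \<Rightarrow> 'a \<Rightarrow> bool" where
  "is_glb G P a b m \<longleftrightarrow> m \<in> carrier G \<and> prefix_le G P m a \<and> prefix_le G P m b \<and>
     (\<forall>c\<in>carrier G. prefix_le G P c a \<and> prefix_le G P c b \<longrightarrow> prefix_le G P c m)"

definition is_lub :: "('a, 'b) monoid_scheme \<Rightarrow> 'a set \<Rightarrow> 'a \<Rightarrow> 'a \<Rightarrow> 'a \<Rightarrow> bool" where
  "is_lub G P a b m \<longleftrightarrow> m \<in> carrier G \<and> prefix_le G P a m \<and> prefix_le G P b m \<and>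
     (\<forall>c\<in>carrier G. prefix_le G P a c \<and> prefix_le G P b c \<longrightarrow> prefix_le G P m c)"

definition simples :: "('a, 'b) monoid_scheme \<Rightarrow> 'a set \<Rightarrow> 'a \<Rightarrow> 'a set" where
  "simples G P D = {s \<in> carrier G. prefix_le G P \<one>\<^bsub>G\<^esub> s \<and> prefix_le G P s D}"

definition atomic :: "('a, 'b) monoid_scheme \<Rightarrow> 'a set \<Rightarrow> bool" where
  "atomic G P \<longleftrightarrow> (\<forall>x\<in>P. \<exists>N::nat. \<forall>xs. set xs \<subseteq> P - {\<one>\<^bsub>G\<^esub>} \<and> gprod G xs = x \<longrightarrow> length xs \<le> N)"

definition garside_group :: "('a, 'b) monoid_scheme \<Rightarrow> 'a set \<Rightarrow> 'a \<Rightarrow> bool" where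
  "garside_group G P D \<longleftrightarrow>
     group G \<and>
     \<comment> \<open>P is the positive monoid of a partial order (a \<preccurlyeq> b iff a^{-1}b \<in> P)\<close>
     P \<subseteq> carrier G \<and> \<one>\<^bsub>G\<^esub> \<in> P \<and>
     (\<forall>x\<in>P. \<forall>y\<in>P. x \<otimes>\<^bsub>G\<^esub> y \<in> P) \<and>
     (\<forall>x\<in>P. inv\<^bsub>G\<^esub> x \<in> P \<longrightarrow> x = \<one>\<^bsub>G\<^esub>) \<and>
     \<comment> \<open>the order is a lattice\<close>
     (\<forall>a\<in>carrier G. \<forall>b\<in>carrier G. (\<exists>m. is_glb G P a b m) \<and> (\<exists>m. is_lub G P a b m)) \<and>
     \<comment> \<open>Garside element\<close>
     D \<in> P \<and>
     finite (simples G P D) \<and>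
     generate G (simples G P D) = carrier G \<and>
     (\<lambda>p. inv\<^bsub>G\<^esub> D \<otimes>\<^bsub>G\<^esub> p \<otimes>\<^bsub>G\<^esub> D) ` P = P \<and>
     atomic G P"

definition gconj :: "('a, 'b) monoid_scheme \<Rightarrow> 'a \<Rightarrow> 'a \<Rightarrow> 'a" where
  "gconj G X a = inv\<^bsub>G\<^esub> a \<otimes>\<^bsub>G\<^esub> X \<otimes>\<^bsub>G\<^esub> a"

definition max_simple_prefix :: "('a, 'b) monoid_scheme \<Rightarrow> 'a set \<Rightarrow> 'a \<Rightarrow> 'a \<Rightarrow> 'a \<Rightarrow> bool" where
  "max_simple_prefix G P D s B \<longleftrightarrow> s \<in> simples G P D \<and> prefix_le G P s B \<and>
     (\<forall>t\<in>simples G P D. prefix_le G P t B \<longrightarrow> prefix_le G P t s)"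

definition left_normal_form :: "('a, 'b) monoid_scheme \<Rightarrow> 'a set \<Rightarrow> 'a \<Rightarrow> 'a \<Rightarrow> int \<Rightarrow> 'a list \<Rightarrow> bool" where
  "left_normal_form G P D X p xs \<longleftrightarrow>
     X = D [^]\<^bsub>G\<^esub> p \<otimes>\<^bsub>G\<^esub> gprod G xs \<and>
     prefix_le G P (D [^]\<^bsub>G\<^esub> p) X \<and>
     (\<forall>q::int. prefix_le G P (D [^]\<^bsub>G\<^esub> q) X \<longrightarrow> q \<le> p) \<and>
     (\<forall>i<length xs. xs ! i \<noteq> \<one>\<^bsub>G\<^esub> \<and> max_simple_prefix G P D (xs ! i) (gprod G (drop i xs)))"

definition ginf :: "('a, 'b) monoid_scheme \<Rightarrow> 'a set \<Rightarrow> 'a \<Rightarrow> 'a \<Rightarrow> int" where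
  "ginf G P D X = (THE p. \<exists>xs. left_normal_form G P D X p xs)"

definition glen :: "('a, 'b) monoid_scheme \<Rightarrow> 'a set \<Rightarrow> 'a \<Rightarrow> 'a \<Rightarrow> nat" where
  "glen G P D X = (THE r. \<exists>p xs. left_normal_form G P D X p xs \<and> length xs = r)"

definition gsup :: "('a, 'b) monoid_scheme \<Rightarrow> 'a set \<Rightarrow> 'a \<Rightarrow> 'a \<Rightarrow> int" where
  "gsup G P D X = ginf G P D X + int (glen G P D X)"

(* iota(X) = tau^{-p}(x_1) = Delta^p x_1 Delta^{-p} if r > 0, and 1 otherwise *)
definition iota :: "('a, 'b) monoid_scheme \<Rightarrow> 'a set \<Rightarrow> 'a \<Rightarrow> 'a \<Rightarrow> 'a" where
  "iota G P D X = (if glen G P D X = 0 then \<one>\<^bsub>G\<^esub>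
     else (let p = ginf G P D X; x1 = hd (THE xs. left_normal_form G P D X p xs)
           in D [^]\<^bsub>G\<^esub> p \<otimes>\<^bsub>G\<^esub> x1 \<otimes>\<^bsub>G\<^esub> D [^]\<^bsub>G\<^esub> (- p)))"

definition cycling :: "('a, 'b) monoid_scheme \<Rightarrow> 'a set \<Rightarrow> 'a \<Rightarrow> 'a \<Rightarrow> 'a" where
  "cycling G P D X = gconj G X (iota G P D X)"

definition conjugate :: "('a, 'b) monoid_scheme \<Rightarrow> 'a \<Rightarrow> 'a \<Rightarrow> bool" where
  "conjugate G X Y \<longleftrightarrow> (\<exists>a\<in>carrier G. Y = gconj G X a)"

definition SSS :: "('a, 'b) monoid_scheme \<Rightarrow> 'a set \<Rightarrow> 'a \<Rightarrow> 'a \<Rightarrow> 'a set" where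
  "SSS G P D X = {Y \<in> carrier G. conjugate G X Y \<and>
     (\<forall>Z\<in>carrier G. conjugate G X Z \<longrightarrow> ginf G P D Z \<le> ginf G P D Y \<and> gsup G P D Y \<le> gsup G P D Z)}"

definition USS :: "('a, 'b) monoid_scheme \<Rightarrow> 'a set \<Rightarrow> 'a \<Rightarrow> 'a \<Rightarrow> 'a set" where
  "USS G P D X = {Y \<in> SSS G P D X. \<exists>m>0. (cycling G P D ^^ m) Y = Y}"

definition minimal_simple :: "('a, 'b) monoid_scheme \<Rightarrow> 'a set \<Rightarrow> 'a \<Rightarrow> 'a \<Rightarrow> 'a \<Rightarrow> 'a \<Rightarrow> bool" where
  "minimal_simple G P D X Y s \<longleftrightarrow>
     s \<in> simples G P D \<and> s \<noteq> \<one>\<^bsub>G\<^esub> \<and> gconj G Y s \<in> USS G P D X \<and>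
     (\<forall>t\<in>carrier G. prefix_le G P \<one>\<^bsub>G\<^esub> t \<and> prefix_le G P t s \<and> t \<noteq> \<one>\<^bsub>G\<^esub> \<and> t \<noteq> s
        \<longrightarrow> gconj G Y t \<notin> USS G P D X)"

definition is_arrow :: "('a, 'b) monoid_scheme \<Rightarrow> 'a set \<Rightarrow> 'a \<Rightarrow> 'a \<Rightarrow> 'a \<Rightarrow> 'a \<Rightarrow> bool" where
  "is_arrow G P D X Y s \<longleftrightarrow> Y \<in> USS G P D X \<and> minimal_simple G P D X Y s"

fun oriented_path :: "('a, 'b) monoid_scheme \<Rightarrow> 'a set \<Rightarrow> 'a \<Rightarrow> 'a \<Rightarrow> 'a \<Rightarrow> 'a list \<Rightarrow> 'a \<Rightarrow> bool" where
  "oriented_path G P D X Y [] Z \<longleftrightarrow> Y \<in> USS G P D X \<and> Y = Z"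
| "oriented_path G P D X Y (s # ss) Z \<longleftrightarrow> is_arrow G P D X Y s \<and> oriented_path G P D X (gconj G Y s) ss Z"

fun black_path :: "('a, 'b) monoid_scheme \<Rightarrow> 'a set \<Rightarrow> 'a \<Rightarrow> 'a \<Rightarrow> 'a list \<Rightarrow> bool" where
  "black_path G P D Y [] \<longleftrightarrow> True"
| "black_path G P D Y (s # ss) \<longleftrightarrow> prefix_le G P s (iota G P D Y) \<and> black_path G P D (gconj G Y s) ss"

fun grey_path :: "('a, 'b) monoid_scheme \<Rightarrow> 'a set \<Rightarrow> 'a \<Rightarrow> 'a \<Rightarrow> 'a list \<Rightarrow> bool" where
  "grey_path G P D Y [] \<longleftrightarrow> True"
| "grey_path G P D Y (s # ss) \<longleftrightarrow> prefix_le G P s (iota G P D (inv\<^bsub>G\<^esub> Y)) \<and> grey_path G P D (gconj G Y s) ss"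

definition path_end :: "('a, 'b) monoid_scheme \<Rightarrow> 'a \<Rightarrow> 'a list \<Rightarrow> 'a" where
  "path_end G Y ss = foldl (gconj G) Y ss"

end

theory Submission
  imports Defs
begin

text \<open>
  Everything rests on the meet \<open>\<and>\<close> of the prefix order, which commutes with left multiplication by
  any element and with right multiplication by powers of \<open>\<Delta>\<close>. With \<open>p = inf Y\<close> and \<open>q = sup Y\<close> one
  has \<open>\<iota>(Y) = Y\<Delta>\<^sup>-\<^sup>p \<and> \<Delta>\<close> and \<open>\<iota>(Y\<^sup>-\<^sup>1) = Y\<^sup>-\<^sup>1\<Delta>\<^sup>q \<and> \<Delta>\<close>. Hence the transport
  \<open>s \<mapsto> \<iota>(Y)\<^sup>-\<^sup>1 s \<iota>(Y\<^sup>s)\<close> of conjugators along cycling preserves meets. For positive \<open>s\<close> with \<open>Y\<close> and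
  \<open>Y\<^sup>s\<close> in \<open>USS(X)\<close> some iterated transport fixes \<open>s\<close>, so \<open>USS(X)\<close> is convex: it contains
  \<open>Y\<^bsup>a \<and> b\<^esup>\<close> whenever it contains \<open>Y\<close>, \<open>Y\<^sup>a\<close>, \<open>Y\<^sup>b\<close>. In particular it contains the conjugate of \<open>Y\<close> by
  \<open>\<iota>(Y\<^sup>-\<^sup>1)\<close>.

  Given a positive conjugator \<open>\<alpha>\<close>, split off grey arrows as long as possible. By convexity what
  remains satisfies \<open>\<alpha> \<and> Y\<^sup>-\<^sup>1\<Delta>\<^sup>q = 1\<close>, that is \<open>Y\<alpha> \<and> \<Delta>\<^sup>q = Y\<close>. For \<open>\<beta> = \<alpha> \<and> \<Delta>\<close> the element \<open>\<beta>\<Delta>\<^sup>p\<close> is a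
  prefix of \<open>Y\<alpha>\<close> because \<open>inf Y\<^sup>\<beta> = p\<close>, and of \<open>\<Delta>\<^sup>q\<close> because \<open>p < q\<close>; so it is a prefix of \<open>Y\<close>, and \<open>\<beta>\<close> is
  a prefix of \<open>\<iota>(Y)\<close>. Therefore \<open>\<beta>\<close> is a product of black arrows, and the condition on \<open>\<alpha>\<close> passes to
  \<open>\<beta>\<^sup>-\<^sup>1\<alpha>\<close>.
\<close>

section \<open>The prefix order\<close>

text \<open>\<open>D_neq_one\<close> makes the powers of \<Delta> strictly increasing, without which
  no exponent would be maximal. The case \<Delta> = 1 is settled separately in the final
  theorem.\<close>

locale garside = group G for G (structure) +
  fixes P :: "'a set" and D :: 'a
  assumes garside: "garside_group G P D"
    and D_neq_one: "D \<noteq> \<one>"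
begin

abbreviation le :: "'a \<Rightarrow> 'a \<Rightarrow> bool"  (infix "\<preceq>" 50)
  where "a \<preceq> b \<equiv> prefix_le G P a b"

definition meet :: "'a \<Rightarrow> 'a \<Rightarrow> 'a"  (infixl "\<^bold>\<and>" 65)
  where "a \<^bold>\<and> b = (SOME m. is_glb G P a b m)"

abbreviation Dp :: "int \<Rightarrow> 'a"  where "Dp k \<equiv> D [^] k"

lemma P_subset: "P \<subseteq> carrier G"
  and one_in_P [simp, intro]: "\<one> \<in> P"
  and P_mult [intro]: "x \<in> P \<Longrightarrow> y \<in> P \<Longrightarrow> x \<otimes> y \<in> P"
  and P_antisym: "x \<in> P \<Longrightarrow> inv x \<in> P \<Longrightarrow> x = \<one>"
  and glb_exists: "a \<in> carrier G \<Longrightarrow> b \<in> carrier G \<Longrightarrow> \<exists>m. is_glb G P a b m"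
  and D_in_P [simp, intro]: "D \<in> P"
  and finite_simples: "finite (simples G P D)"
  and generate_simples: "generate G (simples G P D) = carrier G"
  and P_conj_image: "(\<lambda>p. inv D \<otimes> p \<otimes> D) ` P = P"
  using garside unfolding garside_group_def by auto

lemma P_carrier [simp, intro]: "x \<in> P \<Longrightarrow> x \<in> carrier G"
  using P_subset by blast

lemma inv_cancel_left [simp]:
  "x \<in> carrier G \<Longrightarrow> y \<in> carrier G \<Longrightarrow> inv x \<otimes> (x \<otimes> y) = y"
  "x \<in> carrier G \<Longrightarrow> y \<in> carrier G \<Longrightarrow> x \<otimes> (inv x \<otimes> y) = y"
  by (simp_all flip: m_assoc)

lemma Dp_carrier [simp, intro]: "Dp k \<in> carrier G"
  by simp

lemma Dp_mult [simp]: "Dp k \<otimes> Dp l = Dp (k + l)"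
  by (simp add: int_pow_mult)

lemma Dp_mult_left [simp]: "x \<in> carrier G \<Longrightarrow> Dp k \<otimes> (Dp l \<otimes> x) = Dp (k + l) \<otimes> x"
  by (simp flip: m_assoc)

lemma inv_Dp [simp]: "inv (Dp k) = Dp (- k)"
  by (simp add: int_pow_neg)

lemma Dp_1 [simp]: "Dp 1 = D"
  by (simp add: int_pow_1)

lemma D_carrier [simp, intro]: "D \<in> carrier G"
  by simp

lemma
  shows Dp_mult_D [simp]: "Dp k \<otimes> D = Dp (k + 1)"
    and D_mult_Dp [simp]: "D \<otimes> Dp k = Dp (1 + k)"
    and inv_D_mult_Dp [simp]: "inv D \<otimes> Dp k = Dp (k - 1)"
  using Dp_mult[of k 1] Dp_mult[of 1 k] Dp_mult[of "-1" k] inv_Dp[of 1]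
  by (simp_all del: Dp_mult inv_Dp)

lemma inv_D_mult_Dp_left [simp]:
  "x \<in> carrier G \<Longrightarrow> inv D \<otimes> (Dp k \<otimes> x) = Dp (k - 1) \<otimes> x"
  by (simp flip: m_assoc)

lemma le_refl [simp, intro]: "a \<in> carrier G \<Longrightarrow> a \<preceq> a"
  by (simp add: prefix_le_def)

lemma le_trans [trans]:
  assumes "a \<preceq> b" "b \<preceq> c" "a \<in> carrier G" "b \<in> carrier G" "c \<in> carrier G"
  shows "a \<preceq> c"
proof -
  have "(inv a \<otimes> b) \<otimes> (inv b \<otimes> c) \<in> P"
    using assms unfolding prefix_le_def by blast
  then show ?thesis
    using assms by (simp add: prefix_le_def m_assoc)
qed

lemma le_antisym:
  assumes "a \<preceq> b" "b \<preceq> a" "a \<in> carrier G" "b \<in> carrier G"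
  shows "a = b"
proof -
  have "inv (inv a \<otimes> b) = inv b \<otimes> a"
    using assms by (simp add: inv_mult_group)
  then have "inv a \<otimes> b = \<one>"
    using assms P_antisym unfolding prefix_le_def by metis
  then show ?thesis
    using assms by (metis inv_cancel_left(2) r_one)
qed

lemma le_mult_left_iff [simp]:
  assumes "a \<in> carrier G" "b \<in> carrier G" "c \<in> carrier G"
  shows "c \<otimes> a \<preceq> c \<otimes> b \<longleftrightarrow> a \<preceq> b"
  using assms by (simp add: prefix_le_def inv_mult_group m_assoc)

lemma one_le_iff: "x \<in> carrier G \<Longrightarrow> \<one> \<preceq> x \<longleftrightarrow> x \<in> P"
  by (simp add: prefix_le_def)

lemma P_one_le [simp]: "x \<in> P \<Longrightarrow> \<one> \<preceq> x"
  by (simp add: one_le_iff)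

lemma le_mult_P [intro]: "a \<in> carrier G \<Longrightarrow> x \<in> P \<Longrightarrow> a \<preceq> a \<otimes> x"
  by (simp add: prefix_le_def)

lemma le_one: "x \<in> P \<Longrightarrow> x \<preceq> \<one> \<Longrightarrow> x = \<one>"
  using le_antisym by auto

text \<open>\<open>P\<close> is equal to its image under this conjugation, not merely mapped into
  itself; surjectivity gives the direction from left to right.\<close>

lemma P_conj_D: 
  assumes "x \<in> carrier G"
  shows "inv D \<otimes> x \<otimes> D \<in> P \<longleftrightarrow> x \<in> P"
proof
  assume "inv D \<otimes> x \<otimes> D \<in> P"
  then obtain y where y: "y \<in> P" "inv D \<otimes> x \<otimes> D = inv D \<otimes> y \<otimes> D"
    using P_conj_image by (metis (no_types, lifting) imageE)
  then have "x = y"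
    using assms by (simp add: m_assoc)
  then show "x \<in> P"
    using y by simp
next
  assume "x \<in> P"
  then show "inv D \<otimes> x \<otimes> D \<in> P"
    using P_conj_image by blast
qed

lemma P_conj_Dp:
  assumes "x \<in> carrier G"
  shows "Dp (- k) \<otimes> x \<otimes> Dp k \<in> P \<longleftrightarrow> x \<in> P"
proof -
  have step: "Dp (- (k + 1)) \<otimes> x \<otimes> Dp (k + 1) = inv D \<otimes> (Dp (- k) \<otimes> x \<otimes> Dp k) \<otimes> D" for k
  proof -
    have "Dp (- (k + 1)) = inv D \<otimes> Dp (- k)"
      by (simp only: inv_D_mult_Dp) simp
    moreover have "Dp (k + 1) = Dp k \<otimes> D"
      by simp
    ultimately show ?thesis
      using assms by (simp add: m_assoc)
  qed
  have iff: "Dp (- (k + 1)) \<otimes> x \<otimes> Dp (k + 1) \<in> P \<longleftrightarrow> Dp (- k) \<otimes> x \<otimes> Dp k \<in> P" for k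
    unfolding step using assms by (intro P_conj_D) auto
  show ?thesis
  proof (induction k rule: int_induct[of _ 0])
    case base
    then show ?case using assms by simp
  next
    case (step1 i)
    then show ?case using iff by simp
  next
    case (step2 i)
    then show ?case using iff[of "i - 1"] by simp
  qed
qed

text \<open>The order is left invariant by definition; on the right, multiplication by \<Delta>^k
  conjugates \<open>inv a \<otimes> b\<close> by \<Delta>^k, which preserves
  \<open>P\<close>.\<close>

lemma le_mult_Dp_iff [simp]:
  assumes "a \<in> carrier G" "b \<in> carrier G"
  shows "a \<otimes> Dp k \<preceq> b \<otimes> Dp k \<longleftrightarrow> a \<preceq> b"
  using assms P_conj_Dp[of "inv a \<otimes> b" k]
  by (simp add: prefix_le_def inv_mult_group m_assoc)

lemma le_mult_D_iff [simp]:
  assumes "a \<in> carrier G" "b \<in> carrier G"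
  shows "a \<otimes> D \<preceq> b \<otimes> D \<longleftrightarrow> a \<preceq> b"
  using le_mult_Dp_iff[of a b 1] assms by simp

section \<open>Meets and their behaviour under translations\<close>

lemma
  assumes "a \<in> carrier G" "b \<in> carrier G"
  shows meet_closed [simp, intro]: "a \<^bold>\<and> b \<in> carrier G"
    and meet_le1 [simp, intro]: "a \<^bold>\<and> b \<preceq> a"
    and meet_le2 [simp, intro]: "a \<^bold>\<and> b \<preceq> b"
    and meet_greatest: "c \<in> carrier G \<Longrightarrow> c \<preceq> a \<Longrightarrow> c \<preceq> b \<Longrightarrow> c \<preceq> a \<^bold>\<and> b"
  using someI_ex[OF glb_exists[OF assms]] unfolding meet_def is_glb_def by auto

lemma meet_eqI:
  assumes "a \<in> carrier G" "b \<in> carrier G" "m \<in> carrier G" "m \<preceq> a" "m \<preceq> b"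
    and "\<And>c. c \<in> carrier G \<Longrightarrow> c \<preceq> a \<Longrightarrow> c \<preceq> b \<Longrightarrow> c \<preceq> m"
  shows "a \<^bold>\<and> b = m"
  using assms by (intro le_antisym meet_greatest) auto

lemma le_meet_iff:
  assumes "a \<in> carrier G" "b \<in> carrier G" "c \<in> carrier G"
  shows "c \<preceq> a \<^bold>\<and> b \<longleftrightarrow> c \<preceq> a \<and> c \<preceq> b"
  using assms by (meson le_trans meet_closed meet_greatest meet_le1 meet_le2)

lemma meet_coboundedI1:
  "a \<preceq> c \<Longrightarrow> a \<in> carrier G \<Longrightarrow> b \<in> carrier G \<Longrightarrow> c \<in> carrier G \<Longrightarrow> a \<^bold>\<and> b \<preceq> c"
  by (rule le_trans[OF meet_le1]) auto

lemma meet_coboundedI2: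
  "b \<preceq> c \<Longrightarrow> a \<in> carrier G \<Longrightarrow> b \<in> carrier G \<Longrightarrow> c \<in> carrier G \<Longrightarrow> a \<^bold>\<and> b \<preceq> c"
  by (rule le_trans[OF meet_le2]) auto

lemma meet_eq_left_iff:
  assumes "a \<in> carrier G" "b \<in> carrier G"
  shows "a \<^bold>\<and> b = a \<longleftrightarrow> a \<preceq> b"
  using assms by (metis le_refl meet_eqI meet_le2)

lemma meet_eq_oneI:
  assumes "a \<in> P" "b \<in> P" "\<And>c. c \<in> P \<Longrightarrow> c \<preceq> a \<Longrightarrow> c \<preceq> b \<Longrightarrow> c = \<one>"
  shows "a \<^bold>\<and> b = \<one>"
  using assms by (simp add: meet_greatest flip: one_le_iff)

lemma meet_in_P: "a \<in> P \<Longrightarrow> b \<in> P \<Longrightarrow> a \<^bold>\<and> b \<in> P"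
  by (simp add: meet_greatest flip: one_le_iff)

lemma mult_meet:
  assumes "a \<in> carrier G" "b \<in> carrier G" "c \<in> carrier G"
  shows "c \<otimes> (a \<^bold>\<and> b) = c \<otimes> a \<^bold>\<and> c \<otimes> b"
proof (rule meet_eqI[symmetric])
  fix x assume x: "x \<in> carrier G" "x \<preceq> c \<otimes> a" "x \<preceq> c \<otimes> b"
  then have "c \<otimes> (inv c \<otimes> x) \<preceq> c \<otimes> a" "c \<otimes> (inv c \<otimes> x) \<preceq> c \<otimes> b"
    using assms by simp_all
  then have "inv c \<otimes> x \<preceq> a" "inv c \<otimes> x \<preceq> b"
    using assms x by (simp_all del: inv_cancel_left)
  then have "inv c \<otimes> x \<preceq> a \<^bold>\<and> b"
    using assms x by (simp add: meet_greatest)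
  then have "c \<otimes> (inv c \<otimes> x) \<preceq> c \<otimes> (a \<^bold>\<and> b)"
    using assms x by (simp del: inv_cancel_left)
  then show "x \<preceq> c \<otimes> (a \<^bold>\<and> b)"
    using assms x by simp
qed (use assms in auto)

lemma meet_mult_Dp:
  assumes "a \<in> carrier G" "b \<in> carrier G"
  shows "(a \<^bold>\<and> b) \<otimes> Dp k = a \<otimes> Dp k \<^bold>\<and> b \<otimes> Dp k"
proof (rule meet_eqI[symmetric])
  fix x assume x: "x \<in> carrier G" "x \<preceq> a \<otimes> Dp k" "x \<preceq> b \<otimes> Dp k"
  have eq: "(x \<otimes> Dp (- k)) \<otimes> Dp k = x"
    using x by (simp add: m_assoc)
  have "x \<otimes> Dp (- k) \<preceq> a" "x \<otimes> Dp (- k) \<preceq> b"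
    using assms x eq le_mult_Dp_iff[of "x \<otimes> Dp (- k)" _ k] by auto
  then have "x \<otimes> Dp (- k) \<preceq> a \<^bold>\<and> b"
    using assms x by (simp add: meet_greatest)
  then show "x \<preceq> (a \<^bold>\<and> b) \<otimes> Dp k"
    using assms x eq le_mult_Dp_iff[of "x \<otimes> Dp (- k)" _ k] by fastforce
qed (use assms in auto)

lemma meet_mult_D:
  assumes "a \<in> carrier G" "b \<in> carrier G"
  shows "(a \<^bold>\<and> b) \<otimes> D = a \<otimes> D \<^bold>\<and> b \<otimes> D"
  using meet_mult_Dp[OF assms, of 1] by simp

lemma meet_meet_swap:
  assumes "a \<in> carrier G" "b \<in> carrier G" "c \<in> carrier G" "d \<in> carrier G"
  shows "(a \<^bold>\<and> b) \<^bold>\<and> (c \<^bold>\<and> d) = (a \<^bold>\<and> c) \<^bold>\<and> (b \<^bold>\<and> d)"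
  using assms by (intro le_antisym) (auto simp: le_meet_iff intro: meet_coboundedI1 meet_coboundedI2)

section \<open>Powers of \<Delta> as bounds\<close>

lemma P_Dp: "0 \<le> k \<Longrightarrow> Dp k \<in> P"
proof (induction k rule: int_ge_induct)
  case (step i)
  then have "Dp i \<otimes> D \<in> P"
    by blast
  then show ?case
    by simp
qed simp

text \<open>If k > l, then \<Delta> \<preceq> \<Delta>^(k-l) \<preceq> 1 would force \<Delta> =
  1.\<close>

lemma Dp_le_iff [simp]: "Dp k \<preceq> Dp l \<longleftrightarrow> k \<le> l"
proof
  show "Dp k \<preceq> Dp l" if "k \<le> l"
    using that P_Dp[of "l - k"] by (simp add: prefix_le_def)
next
  show "k \<le> l" if le: "Dp k \<preceq> Dp l"
  proof (rule ccontr)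
    assume "\<not> k \<le> l"
    then have "D \<preceq> Dp (k - l)"
      using P_Dp[of "k - l - 1"] by (simp add: prefix_le_def)
    moreover have "Dp (k - l) \<preceq> \<one>"
      using le by (simp add: prefix_le_def)
    ultimately have "D \<preceq> \<one>"
      by (meson Dp_carrier D_carrier one_closed le_trans)
    then show False
      using D_neq_one le_one by simp
  qed
qed

lemma simples_iff: "s \<in> simples G P D \<longleftrightarrow> s \<in> P \<and> s \<preceq> D"
  unfolding simples_def using one_le_iff by blast

text \<open>Simple elements lie above 1 and their inverses above \<Delta>^(-1). Lower bounds of two
  factors multiply because right multiplication by \<Delta>^l preserves the order.\<close>

lemma Dp_lower_bound:
  assumes "x \<in> carrier G"
  shows "\<exists>k. Dp k \<preceq> x"
proof -
  have "x \<in> generate G (simples G P D)"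
    using assms generate_simples by simp
  then show ?thesis
  proof (induction rule: generate.induct)
    case one
    show ?case by (rule exI[of _ 0]) simp
  next
    case (incl h)
    then show ?case by (intro exI[of _ 0]) (simp add: simples_iff)
  next
    case (inv h)
    then have h: "h \<in> P" "h \<preceq> D" by (auto simp: simples_iff)
    then have "h \<otimes> Dp (- 1) \<preceq> Dp 1 \<otimes> Dp (-1)"
      by (subst le_mult_Dp_iff) auto
    then have "inv h \<otimes> (h \<otimes> Dp (- 1)) \<preceq> inv h \<otimes> \<one>"
      using h by (subst le_mult_left_iff) auto
    then show ?case
      using h by auto
  next
    case (eng h1 h2)
    then obtain k l where kl: "Dp k \<preceq> h1" "Dp l \<preceq> h2" by blast
    have h: "h1 \<in> carrier G" "h2 \<in> carrier G"
      using eng generate_simples by auto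
    have "Dp k \<otimes> Dp l \<preceq> h1 \<otimes> Dp l"
      using kl h by (subst le_mult_Dp_iff) auto
    moreover have "h1 \<otimes> Dp l \<preceq> h1 \<otimes> h2"
      using kl h by simp
    ultimately show ?case
      using h by (metis le_trans Dp_mult Dp_carrier m_closed)
  qed
qed

lemma Dp_le_inv_iff:
  assumes "x \<in> carrier G"
  shows "Dp k \<preceq> inv x \<longleftrightarrow> x \<preceq> Dp (- k)"
proof -
  have "x \<preceq> Dp (- k) \<longleftrightarrow> x \<otimes> Dp k \<preceq> Dp (- k) \<otimes> Dp k"
    using assms by (subst le_mult_Dp_iff) auto
  also have "\<dots> \<longleftrightarrow> inv x \<otimes> (x \<otimes> Dp k) \<preceq> inv x \<otimes> \<one>"
    using assms by (subst le_mult_left_iff) auto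
  finally show ?thesis
    using assms by simp
qed

lemma Dp_upper_bound:
  assumes "x \<in> carrier G"
  shows "\<exists>k. x \<preceq> Dp k"
  using Dp_lower_bound[of "inv x"] assms Dp_le_inv_iff[of x] by auto

section \<open>Normal forms\<close>

text \<open>(a \<and> \<Delta>) \<Delta>^k equals a \<Delta>^k \<and> \<Delta>^(k+1), and
  \<open>a\<close> lies below both terms.\<close>

lemma le_of_meet_D:
  assumes "a \<in> P" "a \<preceq> Dp (k + 1)" "0 \<le> k" 
  shows "a \<preceq> (a \<^bold>\<and> D) \<otimes> Dp k"
  using assms by (simp add: meet_mult_Dp meet_greatest add.commute le_mult_P P_Dp)

text \<open>By \<open>le_of_meet_D\<close> any bound \<Delta>^(n+1) of \<open>a\<close> can be
  lowered to \<Delta>^n, down to 1.\<close>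

lemma meet_D_eq_one:
  assumes "a \<in> P" "a \<^bold>\<and> D = \<one>"
  shows "a = \<one>"
proof -
  have descend: "a \<preceq> Dp (int n) \<Longrightarrow> a = \<one>" for n
  proof (induction n)
    case 0
    then show ?case using assms le_one by simp
  next
    case (Suc n)
    then have "a \<preceq> \<one> \<otimes> Dp (int n)"
      using assms le_of_meet_D[of a "int n"] by (simp add: add.commute)
    then show ?case using Suc by simp
  qed
  obtain k where k: "a \<preceq> Dp k"
    using Dp_upper_bound[of a] assms by auto
  have "Dp k \<preceq> Dp (int (nat k))" by (simp only: Dp_le_iff)
  then have "a \<preceq> Dp (int (nat k))"
    using k assms by (meson le_trans P_carrier Dp_carrier)
  then show ?thesis by (rule descend)
qed

section \<open>Finiteness of intervals\<close>

definition interval :: "'a \<Rightarrow> 'a \<Rightarrow> 'a set"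
  where "interval a b = {x \<in> carrier G. a \<preceq> x \<and> x \<preceq> b}"

text \<open>A positive a \<preceq> \<Delta>^(n+1) is the product of the simple element a \<and>
  \<Delta> and a positive element below \<Delta>^n, so finiteness passes from n to n+1.\<close>

lemma finite_interval_one_Dp: "finite (interval \<one> (Dp (int n)))"
proof (induction n)
  case 0
  have "interval \<one> (Dp (int 0)) \<subseteq> {\<one>}"
    using one_le_iff le_one by (auto simp: interval_def)
  then show ?case using finite_subset by blast
next
  case (Suc n)
  have "interval \<one> (Dp (int (Suc n))) \<subseteq> (\<lambda>(s, x). s \<otimes> x) ` (simples G P D \<times> interval \<one> (Dp (int n)))"
  proof
    fix a assume "a \<in> interval \<one> (Dp (int (Suc n)))"
    then have a: "a \<in> P" "a \<preceq> Dp (int n + 1)"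
      by (auto simp: interval_def one_le_iff add.commute)
    define s where "s = a \<^bold>\<and> D"
    have s: "s \<in> simples G P D" "s \<preceq> a" "s \<in> carrier G"
      using a by (auto simp: s_def simples_iff meet_in_P)
    have "a \<preceq> s \<otimes> Dp (int n)"
      using a le_of_meet_D[of a "int n"] by (simp add: s_def)
    then have "s \<otimes> (inv s \<otimes> a) \<preceq> s \<otimes> Dp (int n)"
      using a s by simp
    then have "inv s \<otimes> a \<preceq> Dp (int n)"
      using a s le_mult_left_iff[of "inv s \<otimes> a" "Dp (int n)" s] by fastforce
    moreover have "\<one> \<preceq> inv s \<otimes> a"
      using s a by (simp add: prefix_le_def)
    ultimately show "a \<in> (\<lambda>(s, x). s \<otimes> x) ` (simples G P D \<times> interval \<one> (Dp (int n)))"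
      using s a by (intro image_eqI[of _ _ "(s, inv s \<otimes> a)"]) (auto simp: interval_def)
  qed
  then show ?case
    using Suc finite_simples finite_subset by blast
qed

lemma finite_interval:
  assumes "a \<in> carrier G" "b \<in> carrier G"
  shows "finite (interval a b)"
proof -
  obtain k where k: "inv a \<otimes> b \<preceq> Dp k"
    using Dp_upper_bound[of "inv a \<otimes> b"] assms by auto
  have "Dp k \<preceq> Dp (int (nat k))" by (simp only: Dp_le_iff)
  then have b: "inv a \<otimes> b \<preceq> Dp (int (nat k))"
    using k assms by (meson le_trans m_closed inv_closed Dp_carrier)
  have "interval a b \<subseteq> (\<otimes>) a ` interval \<one> (Dp (int (nat k)))"
  proof
    fix x assume x: "x \<in> interval a b"
    then have "inv a \<otimes> x \<preceq> inv a \<otimes> b" "\<one> \<preceq> inv a \<otimes> x"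
      using assms by (auto simp: interval_def prefix_le_def[of _ _ \<one>] prefix_le_def[of _ _ a])
    then have "inv a \<otimes> x \<in> interval \<one> (Dp (int (nat k)))"
      using assms b x unfolding interval_def
      by (metis (no_types, lifting) mem_Collect_eq Dp_carrier inv_closed le_trans m_closed)
    then show "x \<in> (\<otimes>) a ` interval \<one> (Dp (int (nat k)))"
      using x assms by (intro image_eqI[of _ _ "inv a \<otimes> x"]) (auto simp: interval_def)
  qed
  then show ?thesis
    using finite_interval_one_Dp finite_subset by blast
qed

text \<open>Multiplication by \<open>b\<close> embeds the smaller interval and misses 1. The size of
  \<open>interval \<one> x\<close> is the measure of the later inductions; it drops when a left
  factor is split off.\<close>

lemma card_interval_less_left:
  assumes "b \<in> P" "b \<noteq> \<one>" "x \<in> P"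
  shows "card (interval \<one> x) < card (interval \<one> (b \<otimes> x))"
proof -
  have inj: "inj_on ((\<otimes>) b) (interval \<one> x)"
    using assms by (auto simp: inj_on_def interval_def)
  have "(\<otimes>) b ` interval \<one> x \<subset> interval \<one> (b \<otimes> x)"
  proof (rule psubsetI)
    show "(\<otimes>) b ` interval \<one> x \<subseteq> interval \<one> (b \<otimes> x)"
      using assms by (auto simp: interval_def one_le_iff)
    have "b \<otimes> y \<noteq> \<one>" if "y \<in> interval \<one> x" for y
    proof
      assume eq: "b \<otimes> y = \<one>"
      have "y \<in> P" using that one_le_iff by (auto simp: interval_def)
      then have "b \<preceq> b \<otimes> y" using assms by auto
      then show False using eq assms le_one by auto
    qed
    moreover have "\<one> \<in> interval \<one> (b \<otimes> x)"
      using assms by (auto simp: interval_def one_le_iff)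
    ultimately show "(\<otimes>) b ` interval \<one> x \<noteq> interval \<one> (b \<otimes> x)"
      by (metis imageE)
  qed
  then show ?thesis
    using assms card_image[OF inj] psubset_card_mono finite_interval
    by (metis P_carrier m_closed one_closed)
qed

lemma card_interval_less_right:
  assumes "t \<in> P" "x \<in> P" "t \<preceq> x" "t \<noteq> x"
  shows "card (interval \<one> t) < card (interval \<one> x)"
proof -
  have "interval \<one> t \<subset> interval \<one> x"
  proof (rule psubsetI)
    show "interval \<one> t \<subseteq> interval \<one> x"
      using assms by (auto simp: interval_def intro: le_trans)
    have "x \<in> interval \<one> x" "x \<notin> interval \<one> t"
      using assms le_antisym by (auto simp: interval_def)
    then show "interval \<one> t \<noteq> interval \<one> x" by blast
  qed
  then show ?thesis
    using assms by (intro psubset_card_mono finite_interval) auto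
qed

section \<open>Lists in normal form\<close>

lemma gprod_Nil [simp]: "gprod G [] = \<one>"
  and gprod_Cons [simp]: "gprod G (x # xs) = x \<otimes> gprod G xs"
  by (simp_all add: gprod_def)

lemma gprod_in_P [intro]: "set xs \<subseteq> P \<Longrightarrow> gprod G xs \<in> P"
  by (induction xs) auto

lemma gprod_append:
  "set xs \<subseteq> P \<Longrightarrow> set ys \<subseteq> P \<Longrightarrow> gprod G (xs @ ys) = gprod G xs \<otimes> gprod G ys"
  by (induction xs) (auto simp: m_assoc gprod_in_P)

text \<open>With the maximal simple prefix written as a meet, normal forms are accessible to the
  meet laws.\<close>

lemma max_simple_prefix_iff:
  assumes "b \<in> P"
  shows "max_simple_prefix G P D s b \<longleftrightarrow> s = b \<^bold>\<and> D"
proof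
  assume *: "max_simple_prefix G P D s b"
  then have "b \<^bold>\<and> D \<preceq> s"
    using assms by (simp add: max_simple_prefix_def simples_iff meet_in_P)
  moreover have "s \<in> P" "s \<preceq> b \<^bold>\<and> D"
    using * assms by (auto simp: max_simple_prefix_def simples_iff meet_greatest)
  ultimately show "s = b \<^bold>\<and> D"
    using assms by (intro le_antisym) auto
qed (use assms in \<open>auto simp: max_simple_prefix_def simples_iff meet_in_P meet_greatest\<close>)

text \<open>Recursive version of the index condition in \<open>left_normal_form\<close>, suited to
  induction; \<open>normal_iff\<close> links the two.\<close>

fun normal :: "'a list \<Rightarrow> bool" where
  "normal [] \<longleftrightarrow> True"
| "normal (x # xs) \<longleftrightarrow> x \<in> P \<and> x \<noteq> \<one> \<and> x = x \<otimes> gprod G xs \<^bold>\<and> D \<and> normal xs"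

lemma normal_subset_P: "normal xs \<Longrightarrow> set xs \<subseteq> P"
  by (induction xs) auto

lemma normal_iff:
  "normal xs \<longleftrightarrow>
    (\<forall>i<length xs. xs ! i \<noteq> \<one> \<and> max_simple_prefix G P D (xs ! i) (gprod G (drop i xs)))"
proof (induction xs)
  case (Cons x xs)
  have "normal (x # xs) \<longleftrightarrow> (x \<noteq> \<one> \<and> max_simple_prefix G P D x (x \<otimes> gprod G xs)) \<and> normal xs"
  proof (cases "x \<in> P \<and> normal xs")
    case True
    then have "x \<otimes> gprod G xs \<in> P"
      using normal_subset_P by blast
    then show ?thesis
      using True by (simp add: max_simple_prefix_iff)
  next
    case False
    then show ?thesis
      by (auto simp: max_simple_prefix_def simples_iff)
  qed
  also have "\<dots> \<longleftrightarrow> (\<forall>i<length (x # xs). (x # xs) ! i \<noteq> \<one> \<and>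
      max_simple_prefix G P D ((x # xs) ! i) (gprod G (drop i (x # xs))))"
    unfolding Cons.IH by (simp only: All_less_Suc2 length_Cons) simp
  finally show ?case .
qed simp

text \<open>Since x = x a \<and> \<Delta>, the bound x a \<preceq> \<Delta>^(m+1) means x a
  \<preceq> x \<Delta>^m, that is a \<preceq> \<Delta>^m: each factor uses up exactly one power of
  \<Delta>.\<close>

lemma normal_gprod_le_Dp_iff: "normal xs \<Longrightarrow> gprod G xs \<preceq> Dp (int n) \<longleftrightarrow> length xs \<le> n"
proof (induction xs arbitrary: n)
  case Nil
  then show ?case by (simp add: one_le_iff P_Dp)
next
  case (Cons x xs)
  define a where "a = gprod G xs"
  have a: "a \<in> P" and x: "x \<in> P" "x \<noteq> \<one>" "x = x \<otimes> a \<^bold>\<and> D"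
    using Cons.prems normal_subset_P by (auto simp: a_def)
  show ?case
  proof (cases n)
    case 0
    have "\<not> x \<otimes> a \<preceq> \<one>"
    proof
      assume "x \<otimes> a \<preceq> \<one>"
      then have "x \<preceq> \<one>"
        using x a by (meson le_mult_P le_trans P_carrier m_closed one_closed)
      then show False using x le_one by blast
    qed
    then show ?thesis using 0 by (simp add: a_def)
  next
    case (Suc m)
    have "x \<otimes> a \<preceq> Dp (int n) \<longleftrightarrow> x \<otimes> a \<preceq> x \<otimes> Dp (int m)"
    proof
      assume "x \<otimes> a \<preceq> Dp (int n)"
      then show "x \<otimes> a \<preceq> x \<otimes> Dp (int m)"
        using le_of_meet_D[of "x \<otimes> a" "int m"] x a Suc by (simp add: add.commute P_mult)
    next
      assume *: "x \<otimes> a \<preceq> x \<otimes> Dp (int m)"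
      have "x \<preceq> D"
        using x a by (metis D_carrier P_carrier m_closed meet_le2)
      then have "x \<otimes> Dp (int m) \<preceq> D \<otimes> Dp (int m)"
        using x by (subst le_mult_Dp_iff) auto
      then have "x \<otimes> Dp (int m) \<preceq> Dp (int n)"
        using Suc by simp
      then show "x \<otimes> a \<preceq> Dp (int n)"
        using * x a by (meson le_trans P_carrier m_closed Dp_carrier)
    qed
    also have "\<dots> \<longleftrightarrow> a \<preceq> Dp (int m)"
      using x a by simp
    also have "\<dots> \<longleftrightarrow> length xs \<le> m"
      using Cons.IH Cons.prems by (simp add: a_def)
    finally show ?thesis
      using Suc by (simp add: a_def)
  qed
qed

text \<open>The product determines the head as its meet with \<Delta>, and the head cancels. The
  empty list is recognised by the length bound 0.\<close>

lemma normal_unique: "normal xs \<Longrightarrow> normal ys \<Longrightarrow> gprod G xs = gprod G ys \<Longrightarrow> xs = ys"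
proof (induction xs arbitrary: ys)
  case Nil
  then have "gprod G ys \<preceq> Dp (int 0)"
    by (simp flip: Nil.prems(3))
  then show ?case
    using normal_gprod_le_Dp_iff[of ys 0] Nil by (metis le_zero_eq length_0_conv)
next
  case (Cons x xs)
  show ?case
  proof (cases ys)
    case Nil
    then show ?thesis
      using Cons.prems normal_gprod_le_Dp_iff[of "x # xs" 0] le_refl[of \<one>] by simp
  next
    case (Cons y zs)
    have P: "x \<in> P" "y \<in> P" "gprod G xs \<in> P" "gprod G zs \<in> P"
      using Cons.prems Cons normal_subset_P by auto
    have "x = y"
      using Cons.prems Cons by (metis gprod_Cons normal.simps(2))
    then have "gprod G xs = gprod G zs"
      using Cons.prems(3) Cons P by simp
    then show ?thesis
      using Cons.IH[of zs] Cons.prems Cons \<open>x = y\<close> by simp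
  qed
qed

text \<open>Greedy construction: split off a \<and> \<Delta>, nontrivial by
  \<open>meet_D_eq_one\<close>, and recurse on the rest.\<close>

lemma normal_exists:
  assumes "a \<in> P"
  shows "\<exists>xs. normal xs \<and> gprod G xs = a"
  using assms
proof (induction "card (interval \<one> a)" arbitrary: a rule: less_induct)
  case less
  show ?case
  proof (cases "a = \<one>")
    case True
    then show ?thesis by (intro exI[of _ "[]"]) simp
  next
    case False
    define s where "s = a \<^bold>\<and> D"
    have s: "s \<in> P" "s \<noteq> \<one>" "s \<preceq> a"
      using less.prems False meet_D_eq_one by (auto simp: s_def meet_in_P)
    have r: "inv s \<otimes> a \<in> P" "s \<otimes> (inv s \<otimes> a) = a"
      using s less.prems by (auto simp: prefix_le_def)
    then obtain xs where xs: "normal xs" "gprod G xs = inv s \<otimes> a"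
      using less.hyps[of "inv s \<otimes> a"] card_interval_less_left[of s "inv s \<otimes> a"] s by auto
    then show ?thesis
      using s r by (intro exI[of _ "s # xs"]) (auto simp: s_def)
  qed
qed

section \<open>Infimum, supremum and \<iota> in terms of the order\<close>

lemma left_normal_form_iff:
  "left_normal_form G P D X p xs \<longleftrightarrow> normal xs \<and> X = Dp p \<otimes> gprod G xs \<and>
     Dp p \<preceq> X \<and> (\<forall>q. Dp q \<preceq> X \<longrightarrow> q \<le> p)"
  unfolding left_normal_form_def normal_iff by blast

lemma left_normal_form_exists:
  assumes "X \<in> carrier G"
  shows "\<exists>p xs. left_normal_form G P D X p xs"
proof -
  obtain k where k: "Dp k \<preceq> X" using Dp_lower_bound assms by blast
  obtain l where l: "X \<preceq> Dp l" using Dp_upper_bound assms by blast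
  have ub: "q \<le> l" if "Dp q \<preceq> X" for q
    using that l assms le_trans[of "Dp q" X "Dp l"] by simp
  define S where "S = {q. k \<le> q \<and> Dp q \<preceq> X}"
  have "S \<subseteq> {k..l}" using ub by (auto simp: S_def)
  then have S: "finite S" "S \<noteq> {}"
    using k finite_subset by (auto simp: S_def)
  define p where "p = Max S"
  have p: "Dp p \<preceq> X" "k \<le> p"
    using Max_in[OF S] by (auto simp: p_def S_def)
  have max: "q \<le> p" if "Dp q \<preceq> X" for q
  proof (cases "k \<le> q")
    case True
    then show ?thesis using that S by (simp add: p_def S_def)
  next
    case False
    then show ?thesis using p by simp
  qed
  have "Dp (- p) \<otimes> X \<in> P"
    using p by (simp add: prefix_le_def)
  then obtain xs where "normal xs" "gprod G xs = Dp (- p) \<otimes> X"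
    using normal_exists by blast
  then have "left_normal_form G P D X p xs"
    using p max assms by (simp add: left_normal_form_iff)
  then show ?thesis by blast
qed

lemma left_normal_form_unique:
  assumes "left_normal_form G P D X p xs" "left_normal_form G P D X q ys"
  shows "p = q" "xs = ys"
proof -
  show pq: "p = q"
    using assms unfolding left_normal_form_iff by (metis order_antisym)
  have "gprod G xs \<in> P" "gprod G ys \<in> P"
    using assms normal_subset_P unfolding left_normal_form_iff by blast+
  moreover have "Dp p \<otimes> gprod G xs = Dp p \<otimes> gprod G ys"
    using assms unfolding left_normal_form_iff pq by metis
  ultimately show "xs = ys"
    using assms unfolding left_normal_form_iff by (metis Dp_carrier P_carrier inv_cancel_left(1) normal_unique)
qed

lemma
  assumes "left_normal_form G P D X p xs"
  shows ginf_eq: "ginf G P D X = p"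
    and glen_eq: "glen G P D X = length xs"
    and the_left_normal_form: "(THE ys. left_normal_form G P D X p ys) = xs"
  unfolding ginf_def glen_def using assms left_normal_form_unique by blast+

text \<open>Together with \<open>le_Dp_iff_gsup\<close> this lets inf and sup be handled through the
  order alone.\<close>

lemma Dp_le_iff_ginf:
  assumes "X \<in> carrier G"
  shows "Dp k \<preceq> X \<longleftrightarrow> k \<le> ginf G P D X"
proof -
  obtain p xs where nf: "left_normal_form G P D X p xs"
    using left_normal_form_exists assms by blast
  then have "Dp p \<preceq> X" "\<And>q. Dp q \<preceq> X \<Longrightarrow> q \<le> p"
    by (auto simp: left_normal_form_iff)
  then show ?thesis
    unfolding ginf_eq[OF nf] using assms le_trans[of "Dp k" "Dp p" X] by auto
qed

text \<open>Cancelling \<Delta>^p leaves a bound on the positive part, and the least power of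
  \<Delta> above that part is its length by \<open>normal_gprod_le_Dp_iff\<close>.\<close>

lemma le_Dp_iff_gsup:
  assumes "X \<in> carrier G"
  shows "X \<preceq> Dp k \<longleftrightarrow> gsup G P D X \<le> k"
proof -
  obtain p xs where nf: "left_normal_form G P D X p xs"
    using left_normal_form_exists assms by blast
  then have xs: "normal xs" "X = Dp p \<otimes> gprod G xs" "gprod G xs \<in> P"
    using normal_subset_P by (auto simp: left_normal_form_iff)
  have "X \<preceq> Dp k \<longleftrightarrow> Dp p \<otimes> gprod G xs \<preceq> Dp p \<otimes> Dp (k - p)"
    using xs by simp
  also have "\<dots> \<longleftrightarrow> gprod G xs \<preceq> Dp (k - p)"
    using xs by (subst le_mult_left_iff) auto
  also have "\<dots> \<longleftrightarrow> p + int (length xs) \<le> k"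
  proof (cases "p \<le> k")
    case True
    then show ?thesis
      using normal_gprod_le_Dp_iff[OF xs(1), of "nat (k - p)"] by auto
  next
    case False
    \<comment> \<open>For k < p the exponent is negative and the length lemma does not apply; both
      sides fail because a positive element lies above 1.\<close>
    have "\<not> gprod G xs \<preceq> Dp (k - p)"
    proof
      assume "gprod G xs \<preceq> Dp (k - p)"
      then have "\<one> \<preceq> Dp (k - p)"
        using xs by (meson le_trans P_one_le P_carrier Dp_carrier one_closed)
      then have "Dp 0 \<preceq> Dp (k - p)" by simp
      then show False using False unfolding Dp_le_iff by simp
    qed
    then show ?thesis using False by simp
  qed
  finally show ?thesis
    by (simp add: gsup_def ginf_eq[OF nf] glen_eq[OF nf])
qed

lemma ginf_inv:
  assumes "X \<in> carrier G"
  shows "ginf G P D (inv X) = - gsup G P D X"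
proof -
  have "k \<le> ginf G P D (inv X) \<longleftrightarrow> k \<le> - gsup G P D X" for k
    using assms Dp_le_iff_ginf[of "inv X" k] Dp_le_inv_iff[of X k] le_Dp_iff_gsup[of X "- k"] by auto
  then show ?thesis by (meson order_antisym order_refl)
qed

text \<open>The first factor is \<Delta>^(-p) X \<and> \<Delta>; multiplication by \<Delta>^p on the
  left and \<Delta>^(-p) on the right passes through the meet.\<close>

lemma iota_eq:
  assumes "X \<in> carrier G"
  shows "iota G P D X = X \<otimes> Dp (- ginf G P D X) \<^bold>\<and> D"
proof -
  obtain p xs where nf: "left_normal_form G P D X p xs"
    using left_normal_form_exists assms by blast
  then have xs: "normal xs" "X = Dp p \<otimes> gprod G xs" "gprod G xs \<in> P"
    using normal_subset_P by (auto simp: left_normal_form_iff)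
  show ?thesis
  proof (cases xs)
    case Nil
    \<comment> \<open>For length 0 the default value 1 agrees with the formula, as X \<Delta>^(-p) =
      1.\<close>
    have "\<one> \<^bold>\<and> D = \<one>" by (simp add: meet_eq_left_iff)
    moreover have "X \<otimes> Dp (- p) = \<one>"
      using Nil xs by simp
    ultimately show ?thesis
      using Nil by (simp add: iota_def glen_eq[OF nf] ginf_eq[OF nf])
  next
    case (Cons x ys)
    then have x: "x = gprod G xs \<^bold>\<and> D" "x \<in> P" using xs by auto
    have "Dp p \<otimes> x \<otimes> Dp (- p) = (Dp p \<otimes> gprod G xs \<^bold>\<and> Dp p \<otimes> D) \<otimes> Dp (- p)"
      using x xs by (metis mult_meet D_carrier Dp_carrier P_carrier)
    also have "\<dots> = X \<otimes> Dp (- p) \<^bold>\<and> D"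
      using xs by (simp add: meet_mult_Dp)
    finally show ?thesis
      using Cons
      by (simp add: iota_def glen_eq[OF nf] ginf_eq[OF nf] the_left_normal_form[OF nf])
  qed
qed

section \<open>Convexity of the ultra summit set\<close>

lemma gconj_closed [simp, intro]:
  "Y \<in> carrier G \<Longrightarrow> a \<in> carrier G \<Longrightarrow> gconj G Y a \<in> carrier G"
  by (simp add: gconj_def)

lemma gconj_one [simp]: "Y \<in> carrier G \<Longrightarrow> gconj G Y \<one> = Y"
  by (simp add: gconj_def)

lemma gconj_mult:
  assumes "Y \<in> carrier G" "a \<in> carrier G" "b \<in> carrier G"
  shows "gconj G Y (a \<otimes> b) = gconj G (gconj G Y a) b"
  using assms by (simp add: gconj_def inv_mult_group m_assoc)

lemma
  assumes "Y \<in> carrier G" "a \<in> carrier G"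
  shows gconj_self_mult: "gconj G Y (Y \<otimes> a) = gconj G Y a"
    and gconj_inv_self_mult: "gconj G Y (inv Y \<otimes> a) = gconj G Y a"
  using assms by (simp_all add: gconj_def inv_mult_group m_assoc)

lemma mult_gconj:
  "Y \<in> carrier G \<Longrightarrow> a \<in> carrier G \<Longrightarrow> a \<otimes> gconj G Y a = Y \<otimes> a"
  by (simp add: gconj_def m_assoc)

text \<open>After multiplication by \<open>a\<close> from the left the bounds no longer contain
  \<open>inv a\<close>, and both sides are compatible with meets in \<open>a\<close>.\<close>

lemma
  assumes "Y \<in> carrier G" "a \<in> carrier G"
  shows Dp_le_gconj_iff: "Dp k \<preceq> gconj G Y a \<longleftrightarrow> a \<otimes> Dp k \<preceq> Y \<otimes> a"
    and gconj_le_Dp_iff: "gconj G Y a \<preceq> Dp k \<longleftrightarrow> Y \<otimes> a \<preceq> a \<otimes> Dp k"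
  using assms le_mult_left_iff[of "Dp k" "gconj G Y a" a] le_mult_left_iff[of "gconj G Y a" "Dp k" a]
  by (simp_all add: mult_gconj)

lemma SSS_carrier [simp]: "Y \<in> SSS G P D X \<Longrightarrow> Y \<in> carrier G"
  by (simp add: SSS_def)

lemma
  assumes "Y \<in> SSS G P D X" "Z \<in> SSS G P D X"
  shows SSS_ginf: "ginf G P D Z = ginf G P D Y"
    and SSS_gsup: "gsup G P D Z = gsup G P D Y"
  using assms unfolding SSS_def by (auto intro: order_antisym)

text \<open>inf and sup are constant and extremal on the super summit set, so a conjugate belongs to
  it as soon as it satisfies the two bounds.\<close>

lemma SSS_gconj_iff:
  assumes X: "X \<in> carrier G" and Y: "Y \<in> SSS G P D X" and a: "a \<in> carrier G"
  shows "gconj G Y a \<in> SSS G P D X \<longleftrightarrow>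
    a \<otimes> Dp (ginf G P D Y) \<preceq> Y \<otimes> a \<and> Y \<otimes> a \<preceq> a \<otimes> Dp (gsup G P D Y)" (is "_ \<longleftrightarrow> ?R")
proof -
  have Yc: "Y \<in> carrier G" using Y by simp
  have R: "?R \<longleftrightarrow> ginf G P D Y \<le> ginf G P D (gconj G Y a) \<and> gsup G P D (gconj G Y a) \<le> gsup G P D Y"
    using Yc a Dp_le_gconj_iff[of Y a] gconj_le_Dp_iff[of Y a] Dp_le_iff_ginf[of "gconj G Y a"]
      le_Dp_iff_gsup[of "gconj G Y a"] by simp
  obtain b where b: "b \<in> carrier G" "Y = gconj G X b"
    using Y unfolding SSS_def conjugate_def by blast
  have conj: "conjugate G X (gconj G Y a)"
    unfolding conjugate_def using a b X gconj_mult by (metis m_closed)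
  show ?thesis
  proof
    assume "gconj G Y a \<in> SSS G P D X"
    then show ?R unfolding R using SSS_ginf SSS_gsup Y by (metis order_refl)
  next
    assume ?R
    then show "gconj G Y a \<in> SSS G P D X"
      using Y conj a Yc unfolding R SSS_def by fastforce
  qed
qed

text \<open>Take meets of the inequalities in \<open>SSS_gconj_iff\<close> for \<open>a\<close> and
  for \<open>b\<close>; every side is a translate of \<open>a\<close> or \<open>b\<close>.\<close>

lemma SSS_meet:
  assumes X: "X \<in> carrier G" and Y: "Y \<in> SSS G P D X"
    and a: "a \<in> carrier G" "gconj G Y a \<in> SSS G P D X"
    and b: "b \<in> carrier G" "gconj G Y b \<in> SSS G P D X"
  shows "gconj G Y (a \<^bold>\<and> b) \<in> SSS G P D X"
proof -
  have Yc: "Y \<in> carrier G" using Y by simp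
  define p q where "p = ginf G P D Y" and "q = gsup G P D Y"
  have a': "a \<otimes> Dp p \<preceq> Y \<otimes> a" "Y \<otimes> a \<preceq> a \<otimes> Dp q"
    using a SSS_gconj_iff[OF X Y] by (auto simp: p_def q_def)
  have b': "b \<otimes> Dp p \<preceq> Y \<otimes> b" "Y \<otimes> b \<preceq> b \<otimes> Dp q"
    using b SSS_gconj_iff[OF X Y] by (auto simp: p_def q_def)
  have "a \<otimes> Dp p \<^bold>\<and> b \<otimes> Dp p \<preceq> Y \<otimes> a \<^bold>\<and> Y \<otimes> b"
    using a b Yc a' b' by (intro meet_greatest) (auto intro: meet_coboundedI1 meet_coboundedI2)
  moreover have "Y \<otimes> a \<^bold>\<and> Y \<otimes> b \<preceq> a \<otimes> Dp q \<^bold>\<and> b \<otimes> Dp q"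
    using a b Yc a' b' by (intro meet_greatest) (auto intro: meet_coboundedI1 meet_coboundedI2)
  ultimately show ?thesis
    using a b Yc SSS_gconj_iff[OF X Y, of "a \<^bold>\<and> b"] by (simp add: meet_mult_Dp mult_meet p_def q_def)
qed

text \<open>Conjugation by \<Delta>^k preserves the order and fixes the powers of \<Delta>.\<close>

lemma SSS_gconj_Dp:
  assumes X: "X \<in> carrier G" and Y: "Y \<in> SSS G P D X"
  shows "gconj G Y (Dp k) \<in> SSS G P D X"
proof -
  have Yc: "Y \<in> carrier G" using Y by simp
  have "Dp (ginf G P D Y) \<preceq> Y" "Y \<preceq> Dp (gsup G P D Y)"
    using Yc by (simp_all add: Dp_le_iff_ginf le_Dp_iff_gsup)
  then have "Dp (ginf G P D Y) \<otimes> Dp k \<preceq> Y \<otimes> Dp k" "Y \<otimes> Dp k \<preceq> Dp (gsup G P D Y) \<otimes> Dp k"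
    using Yc by (simp_all only: le_mult_Dp_iff Dp_carrier)
  then show ?thesis
    using SSS_gconj_iff[OF X Y] by (simp add: add.commute)
qed

lemma iota_closed [simp, intro]: "Y \<in> carrier G \<Longrightarrow> iota G P D Y \<in> carrier G"
  by (simp add: iota_eq)

lemma cycling_closed [simp, intro]: "Y \<in> carrier G \<Longrightarrow> cycling G P D Y \<in> carrier G"
  by (simp add: cycling_def)

text \<open>
  \<open>\<iota>(Y)\<close> is the meet of \<open>Y \<Delta>\<^sup>-\<^sup>p\<close> and \<open>\<Delta>\<close>, both of which conjugate \<open>Y\<close> to a power of \<open>\<tau>\<close> applied
  to \<open>Y\<close>.
\<close>
lemma SSS_cycling:
  assumes X: "X \<in> carrier G" and Y: "Y \<in> SSS G P D X"
  shows "cycling G P D Y \<in> SSS G P D X"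
proof -
  have Yc: "Y \<in> carrier G" using Y by simp
  have "gconj G Y (Y \<otimes> Dp (- ginf G P D Y)) \<in> SSS G P D X"
    using SSS_gconj_Dp[OF X Y] Yc by (simp add: gconj_self_mult)
  moreover have "gconj G Y D \<in> SSS G P D X"
    using SSS_gconj_Dp[OF X Y, of 1] by simp
  ultimately show ?thesis
    unfolding cycling_def using Yc by (simp add: iota_eq SSS_meet[OF X Y])
qed

section \<open>Iterated cycling and the transport of conjugators\<close>

lemma SSS_cycling_funpow:
  "X \<in> carrier G \<Longrightarrow> Y \<in> SSS G P D X \<Longrightarrow> (cycling G P D ^^ n) Y \<in> SSS G P D X"
  by (induction n) (auto simp: SSS_cycling)

lemma cycling_funpow_closed [simp, intro]: "Y \<in> carrier G \<Longrightarrow> (cycling G P D ^^ n) Y \<in> carrier G"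
  by (induction n) auto

primrec iotas :: "nat \<Rightarrow> 'a \<Rightarrow> 'a" where
  "iotas 0 Y = \<one>"
| "iotas (Suc n) Y = iotas n Y \<otimes> iota G P D ((cycling G P D ^^ n) Y)"

lemma iotas_closed [simp, intro]: "Y \<in> carrier G \<Longrightarrow> iotas n Y \<in> carrier G"
  by (induction n) auto

lemma cycling_funpow_eq: "Y \<in> carrier G \<Longrightarrow> (cycling G P D ^^ n) Y = gconj G Y (iotas n Y)"
  by (induction n) (auto simp: gconj_mult cycling_def)

lemma iotas_add:
  "Y \<in> carrier G \<Longrightarrow> iotas (m + n) Y = iotas m Y \<otimes> iotas n ((cycling G P D ^^ m) Y)"
proof (induction n)
  case (Suc n)
  have "(cycling G P D ^^ n) ((cycling G P D ^^ m) Y) = (cycling G P D ^^ (m + n)) Y"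
    using funpow_add[of n m "cycling G P D"] by (simp add: add.commute)
  then show ?case
    using Suc by (simp add: m_assoc)
qed simp

lemma cycling_funpow_period:
  "(cycling G P D ^^ n) Y = Y \<Longrightarrow> (cycling G P D ^^ (n * k)) Y = Y"
  by (induction k) (auto simp: funpow_add)

lemma iotas_period:
  assumes "Y \<in> carrier G" "(cycling G P D ^^ n) Y = Y"
  shows "iotas (n * k) Y = iotas n Y [^] k"
proof (induction k)
  case (Suc k)
  have "iotas (n * k + n) Y = iotas n Y [^] k \<otimes> iotas n Y"
    using assms Suc by (simp add: iotas_add cycling_funpow_period)
  then show ?case by (simp add: add.commute)
qed simp

text \<open>Fourth side of the square formed by \<open>s\<close> and the n-fold cyclings of
  \<open>Y\<close> and \<open>gconj G Y s\<close>; by \<open>gconj_transport\<close> it joins the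
  two cycled elements.\<close>

definition transport :: "nat \<Rightarrow> 'a \<Rightarrow> 'a \<Rightarrow> 'a" where
  "transport n Y s = inv (iotas n Y) \<otimes> s \<otimes> iotas n (gconj G Y s)"

lemma transport_closed [simp, intro]:
  "Y \<in> carrier G \<Longrightarrow> s \<in> carrier G \<Longrightarrow> transport n Y s \<in> carrier G"
  by (simp add: transport_def)

lemma gconj_transport:
  assumes "Y \<in> carrier G" "s \<in> carrier G"
  shows "gconj G ((cycling G P D ^^ n) Y) (transport n Y s) = (cycling G P D ^^ n) (gconj G Y s)"
  using assms by (simp add: cycling_funpow_eq transport_def flip: gconj_mult) (simp add: m_assoc)

lemma transport_0 [simp]: "s \<in> carrier G \<Longrightarrow> transport 0 Y s = s"
  by (simp add: transport_def)

lemma transport_Suc: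
  assumes "Y \<in> carrier G" "s \<in> carrier G"
  shows "transport (Suc n) Y s = transport (Suc 0) ((cycling G P D ^^ n) Y) (transport n Y s)"
proof -
  define T where "T = transport n Y s"
  have "gconj G ((cycling G P D ^^ n) Y) T = (cycling G P D ^^ n) (gconj G Y s)"
    using assms by (simp add: T_def gconj_transport)
  then have "transport (Suc 0) ((cycling G P D ^^ n) Y) T =
      inv (iota G P D ((cycling G P D ^^ n) Y)) \<otimes> T \<otimes> iota G P D ((cycling G P D ^^ n) (gconj G Y s))"
    using assms by (simp add: transport_def)
  then show ?thesis
    using assms by (simp add: T_def transport_def inv_mult_group m_assoc)
qed

text \<open>As \<open>Y\<close> and its conjugate have equal infimum, s \<iota>(Y^s) = Y s
  \<Delta>^(-p) \<and> s \<Delta>, a meet of two translates of \<open>s\<close>.\<close>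

lemma transport_1:
  assumes Y: "Y \<in> SSS G P D X"
    and s: "s \<in> carrier G" "gconj G Y s \<in> SSS G P D X"
  shows "transport (Suc 0) Y s = inv (iota G P D Y) \<otimes> (Y \<otimes> s \<otimes> Dp (- ginf G P D Y) \<^bold>\<and> s \<otimes> D)"
proof -
  have Yc: "Y \<in> carrier G" using Y by simp
  have "s \<otimes> iota G P D (gconj G Y s) = (s \<otimes> gconj G Y s) \<otimes> Dp (- ginf G P D Y) \<^bold>\<and> s \<otimes> D"
    using Yc s by (simp add: iota_eq SSS_ginf[OF Y s(2)] mult_meet m_assoc)
  then show ?thesis
    using Yc s by (simp add: transport_def m_assoc mult_gconj)
qed

lemma transport_meet:
  assumes X: "X \<in> carrier G" and Y: "Y \<in> SSS G P D X"
    and s: "s \<in> carrier G" "gconj G Y s \<in> SSS G P D X"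
    and t: "t \<in> carrier G" "gconj G Y t \<in> SSS G P D X"
  shows "transport n Y (s \<^bold>\<and> t) = transport n Y s \<^bold>\<and> transport n Y t"
proof -
  \<comment> \<open>A single transport: by \<open>transport_1\<close> this is a rearrangement of a
    meet of four elements.\<close>
  have one: "transport (Suc 0) W (u \<^bold>\<and> v) = transport (Suc 0) W u \<^bold>\<and> transport (Suc 0) W v"
    if W: "W \<in> SSS G P D X" and u: "u \<in> carrier G" "gconj G W u \<in> SSS G P D X"
      and v: "v \<in> carrier G" "gconj G W v \<in> SSS G P D X" for W u v
  proof -
    define p where "p = - ginf G P D W"
    have Wc: "W \<in> carrier G" using W by simp
    have "W \<otimes> (u \<^bold>\<and> v) \<otimes> Dp p \<^bold>\<and> (u \<^bold>\<and> v) \<otimes> D =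
        (W \<otimes> u \<otimes> Dp p \<^bold>\<and> u \<otimes> D) \<^bold>\<and> (W \<otimes> v \<otimes> Dp p \<^bold>\<and> v \<otimes> D)"
      using u v Wc
      by (simp only: mult_meet meet_mult_Dp meet_mult_D m_closed Dp_carrier D_carrier)
        (rule meet_meet_swap; simp)
    then show ?thesis
      using u v Wc SSS_meet[OF X W u v]
      by (simp add: transport_1[OF W] p_def mult_meet)
  qed
  have Yc: "Y \<in> carrier G" using Y by simp
  show ?thesis
  proof (induction n)
    case (Suc n)
    have "gconj G ((cycling G P D ^^ n) Y) (transport n Y u) \<in> SSS G P D X"
      if "u \<in> carrier G" "gconj G Y u \<in> SSS G P D X" for u
      using that Yc X by (simp add: gconj_transport SSS_cycling_funpow)
    then have "transport (Suc 0) ((cycling G P D ^^ n) Y) (transport n Y s \<^bold>\<and> transport n Y t) =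
        transport (Suc n) Y s \<^bold>\<and> transport (Suc n) Y t"
      using s t Yc X Y by (simp only: transport_Suc one SSS_cycling_funpow transport_closed)
    then show ?case
      using s t Yc by (simp only: transport_Suc meet_closed Suc)
  qed (use s t in simp)
qed

text \<open>Here the meet in \<open>transport_1\<close> is \<iota>(W) \<Delta>^k, and \<iota>(W)
  cancels.\<close>

lemma transport_Dp:
  assumes X: "X \<in> carrier G" and Y: "Y \<in> SSS G P D X"
  shows "transport n Y (Dp k) = Dp k"
proof (induction n)
  case (Suc n)
  define W where "W = (cycling G P D ^^ n) Y"
  have W: "W \<in> SSS G P D X" "W \<in> carrier G"
    using X Y by (simp_all add: W_def SSS_cycling_funpow)
  have "W \<otimes> Dp k \<otimes> Dp (- ginf G P D W) \<^bold>\<and> Dp k \<otimes> D = iota G P D W \<otimes> Dp k"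
    using W by (simp add: iota_eq meet_mult_Dp m_assoc add.commute)
  then have "transport (Suc 0) ((cycling G P D ^^ n) Y) (Dp k) = Dp k"
    unfolding W_def[symmetric]
    using W SSS_gconj_Dp[OF X W(1)] by (simp add: transport_1)
  then show ?case
    using Suc Y transport_Suc[of Y "Dp k" n] by (metis SSS_carrier Dp_carrier)
qed simp

text \<open>Transport preserves meets, hence the order, and it fixes 1 and \<Delta>^k.\<close>

lemma transport_in_interval:
  assumes X: "X \<in> carrier G" and Y: "Y \<in> SSS G P D X"
    and s: "gconj G Y s \<in> SSS G P D X" "s \<in> interval \<one> (Dp k)"
  shows "transport n Y s \<in> interval \<one> (Dp k)"
proof -
  have Yc: "Y \<in> carrier G" and sc: "s \<in> carrier G"
    using Y s by (auto simp: interval_def)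
  have le: "\<one> \<preceq> s" "s \<preceq> Dp k" using s by (auto simp: interval_def)
  have "transport n Y \<one> = \<one>"
    using transport_Dp[OF X Y, of n 0] by simp
  moreover have "transport n Y (\<one> \<^bold>\<and> s) = transport n Y \<one> \<^bold>\<and> transport n Y s"
    using X Y Yc s sc by (intro transport_meet) auto
  ultimately have "\<one> \<preceq> transport n Y s"
    using le sc Yc by (metis meet_eq_left_iff one_closed transport_closed)
  moreover have "transport n Y (s \<^bold>\<and> Dp k) = transport n Y s \<^bold>\<and> Dp k"
    using transport_meet[OF X Y sc s(1) Dp_carrier SSS_gconj_Dp[OF X Y]] transport_Dp[OF X Y] by simp
  then have "transport n Y s \<preceq> Dp k"
    using le sc Yc by (metis meet_eq_left_iff Dp_carrier transport_closed)
  ultimately show ?thesis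
    using Yc sc by (simp add: interval_def)
qed

section \<open>Periodic conjugators and convexity of USS(X)\<close>

lemma USS_SSS: "Y \<in> USS G P D X \<Longrightarrow> Y \<in> SSS G P D X"
  by (simp add: USS_def)

lemma USS_carrier [simp]: "Y \<in> USS G P D X \<Longrightarrow> Y \<in> carrier G"
  using USS_SSS SSS_carrier by blast

text \<open>
  Along a common period \<open>n\<close> of \<open>Y\<close> and \<open>Y\<^sup>s\<close>, the \<open>k\<close>-fold transport of \<open>s\<close> is \<open>C\<^sup>-\<^sup>k s C'\<^sup>k\<close> with
  fixed \<open>C\<close> and \<open>C'\<close>, so two equal transports cancel to a fixed point.
\<close>
lemma transport_fixed:
  assumes X: "X \<in> carrier G" and Y: "Y \<in> USS G P D X"
    and s: "s \<in> P" "gconj G Y s \<in> USS G P D X"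
  shows "\<exists>n>0. (cycling G P D ^^ n) Y = Y \<and> (cycling G P D ^^ n) (gconj G Y s) = gconj G Y s \<and>
    transport n Y s = s"
proof -
  define W where "W = gconj G Y s"
  have c: "Y \<in> carrier G" "s \<in> carrier G" "W \<in> carrier G"
    using Y s by (auto simp: W_def)
  obtain m where m: "m > 0" "(cycling G P D ^^ m) Y = Y"
    using Y by (auto simp: USS_def)
  obtain m' where m': "m' > 0" "(cycling G P D ^^ m') W = W"
    using s by (auto simp: USS_def W_def)
  define n where "n = m * m'"
  have n: "n > 0" "(cycling G P D ^^ n) Y = Y" "(cycling G P D ^^ n) W = W"
    using m m' cycling_funpow_period[of m Y m'] cycling_funpow_period[of m' W m]
    by (simp_all add: n_def mult.commute)
  define C C' where "C = iotas n Y" and "C' = iotas n W"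
  have C: "C \<in> carrier G" "C' \<in> carrier G"
    using c by (auto simp: C_def C'_def)
  have tr: "transport (n * k) Y s = inv (C [^] k) \<otimes> s \<otimes> C' [^] k" for k
    using n c by (simp add: transport_def iotas_period C_def C'_def flip: W_def)
  \<comment> \<open>The iterated transports of \<open>s\<close> lie in a finite interval, so two of
    them coincide.\<close>
  obtain l where "s \<preceq> Dp l" using Dp_upper_bound c by blast
  then have "s \<in> interval \<one> (Dp l)"
    using s by (auto simp: interval_def)
  then have "range (\<lambda>k. transport (n * k) Y s) \<subseteq> interval \<one> (Dp l)"
    using transport_in_interval[OF X USS_SSS[OF Y] USS_SSS[OF s(2)]] by blast
  then have "finite (range (\<lambda>k. transport (n * k) Y s))"
    using finite_interval finite_subset by (metis Dp_carrier one_closed)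
  then have "\<not> inj (\<lambda>k. transport (n * k) Y s)"
    using finite_imageD infinite_UNIV_nat by blast
  then obtain i j where "i < j" "transport (n * i) Y s = transport (n * j) Y s"
    unfolding inj_def by (metis linorder_neqE_nat)
  moreover define d where "d = j - i"
  ultimately have d: "d > 0" "j = i + d" "transport (n * i) Y s = transport (n * j) Y s"
    by auto
  have cancel: "s = inv B \<otimes> s \<otimes> B'"
    if "inv A \<otimes> s \<otimes> A' = inv (B \<otimes> A) \<otimes> s \<otimes> (B' \<otimes> A')"
      "A \<in> carrier G" "A' \<in> carrier G" "B \<in> carrier G" "B' \<in> carrier G" for A A' B B'
  proof -
    have "inv A \<otimes> (s \<otimes> A') = inv A \<otimes> (inv B \<otimes> s \<otimes> B' \<otimes> A')"
      using that c by (simp add: inv_mult_group m_assoc)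
    then have "s \<otimes> A' = inv B \<otimes> s \<otimes> B' \<otimes> A'"
      using that c by (metis inv_cancel_left(2) inv_closed m_closed)
    then show ?thesis
      using that c by simp
  qed
  have "C [^] j = C [^] d \<otimes> C [^] i" "C' [^] j = C' [^] d \<otimes> C' [^] i"
    using C d(2) by (simp_all add: nat_pow_mult add.commute)
  then have "s = inv (C [^] d) \<otimes> s \<otimes> C' [^] d"
    using d(3) C unfolding tr by (intro cancel[of "C [^] i" "C' [^] i"]) auto
  then have "transport (n * d) Y s = s"
    unfolding tr by simp
  then show ?thesis
    using d n by (intro exI[of _ "n * d"]) (auto simp: cycling_funpow_period simp flip: W_def)
qed

text \<open>Being fixed means C s = s C', hence C^k s = s C'^k. This provides a common period for
  two fixed conjugators.\<close>

lemma transport_fixed_mult: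
  assumes "Y \<in> carrier G" "s \<in> carrier G" "(cycling G P D ^^ n) Y = Y"
    and "(cycling G P D ^^ n) (gconj G Y s) = gconj G Y s" "transport n Y s = s"
  shows "transport (n * k) Y s = s"
proof -
  define C C' where "C = iotas n Y" and "C' = iotas n (gconj G Y s)"
  have C: "C \<in> carrier G" "C' \<in> carrier G"
    using assms by (auto simp: C_def C'_def)
  have "C \<otimes> (inv C \<otimes> (s \<otimes> C')) = C \<otimes> s"
    using assms C by (simp add: transport_def m_assoc flip: C_def C'_def)
  then have comm: "C \<otimes> s = s \<otimes> C'"
    using assms(2) C by simp
  have "C [^] k \<otimes> s = s \<otimes> C' [^] k"
  proof (induction k)
    case (Suc k)
    have "C [^] Suc k \<otimes> s = C [^] k \<otimes> s \<otimes> C'"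
      using assms(2) C by (simp add: m_assoc comm)
    then show ?case
      using assms(2) C by (simp add: Suc m_assoc)
  qed (use assms(2) in simp)
  then have "inv (C [^] k) \<otimes> s \<otimes> C' [^] k = s"
    using assms(2) C by (metis inv_cancel_left(1) m_assoc inv_closed nat_pow_closed)
  then show ?thesis
    using assms by (simp add: transport_def iotas_period C_def C'_def)
qed

text \<open>For a common multiple N of the periods, transport fixes \<open>a\<close> and
  \<open>b\<close>, hence also their meet; by \<open>gconj_transport\<close>, N cyclings then return
  the conjugate by a \<and> b to itself.\<close>

theorem USS_meet:
  assumes X: "X \<in> carrier G" and Y: "Y \<in> USS G P D X"
    and a: "a \<in> P" "gconj G Y a \<in> USS G P D X"
    and b: "b \<in> P" "gconj G Y b \<in> USS G P D X"
  shows "gconj G Y (a \<^bold>\<and> b) \<in> USS G P D X"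
proof -
  have Yc: "Y \<in> carrier G" using Y by simp
  obtain m where m: "m > 0" "(cycling G P D ^^ m) Y = Y"
      "(cycling G P D ^^ m) (gconj G Y a) = gconj G Y a" "transport m Y a = a"
    using transport_fixed[OF X Y a] by blast
  obtain n where n: "n > 0" "(cycling G P D ^^ n) Y = Y"
      "(cycling G P D ^^ n) (gconj G Y b) = gconj G Y b" "transport n Y b = b"
    using transport_fixed[OF X Y b] by blast
  have "transport (m * n) Y a = a" "transport (m * n) Y b = b"
    using transport_fixed_mult[of Y a m n] transport_fixed_mult[of Y b n m] Yc a b m n
    by (simp_all add: mult.commute)
  then have "transport (m * n) Y (a \<^bold>\<and> b) = a \<^bold>\<and> b"
    using transport_meet[OF X USS_SSS[OF Y] _ USS_SSS[OF a(2)] _ USS_SSS[OF b(2)]] a b by simp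
  then have "(cycling G P D ^^ (m * n)) (gconj G Y (a \<^bold>\<and> b)) = gconj G Y (a \<^bold>\<and> b)"
    using gconj_transport[of Y "a \<^bold>\<and> b" "m * n"] Yc a b m by (simp add: cycling_funpow_period)
  moreover have "gconj G Y (a \<^bold>\<and> b) \<in> SSS G P D X"
    using X Y a b by (intro SSS_meet) (auto intro: USS_SSS)
  ultimately show ?thesis
    using m n unfolding USS_def by (auto intro!: exI[of _ "m * n"])
qed

lemma USS_gconj_Dp:
  assumes X: "X \<in> carrier G" and Y: "Y \<in> USS G P D X"
  shows "gconj G Y (Dp k) \<in> USS G P D X"
proof -
  have Yc: "Y \<in> carrier G" using Y by simp
  obtain n where n: "n > 0" "(cycling G P D ^^ n) Y = Y"
    using Y by (auto simp: USS_def)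
  then have "(cycling G P D ^^ n) (gconj G Y (Dp k)) = gconj G Y (Dp k)"
    using gconj_transport[of Y "Dp k" n] Yc transport_Dp[OF X USS_SSS[OF Y]] by simp
  then show ?thesis
    using n SSS_gconj_Dp[OF X USS_SSS[OF Y]] by (auto simp: USS_def)
qed

section \<open>Grey and black paths\<close>

lemma gconj_inv_mult:
  assumes "Y \<in> carrier G" "a \<in> carrier G" "b \<in> carrier G"
  shows "gconj G (gconj G Y a) (inv a \<otimes> b) = gconj G Y b"
  using assms by (simp flip: gconj_mult)

lemma iota_inv_eq:
  assumes "Y \<in> carrier G"
  shows "iota G P D (inv Y) = inv Y \<otimes> Dp (gsup G P D Y) \<^bold>\<and> D"
  using assms by (simp add: iota_eq ginf_inv)

lemma inv_mult_Dp_gsup_in_P: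
  assumes "Y \<in> carrier G"
  shows "inv Y \<otimes> Dp (gsup G P D Y) \<in> P"
  using assms le_Dp_iff_gsup[of Y "gsup G P D Y"] by (simp add: prefix_le_def)

lemma iota_inv_in_P: "Y \<in> carrier G \<Longrightarrow> iota G P D (inv Y) \<in> P"
  by (simp add: iota_inv_eq inv_mult_Dp_gsup_in_P meet_in_P)

text \<open>\<iota>(Y^-1) is the meet of \<Delta> and Y^-1 \<Delta>^q, and the latter conjugates
  \<open>Y\<close> as \<Delta>^q does. Both are positive, so \<open>USS_meet\<close>
  applies.\<close>

lemma USS_gconj_iota_inv:
  assumes X: "X \<in> carrier G" and Y: "Y \<in> USS G P D X"
  shows "gconj G Y (iota G P D (inv Y)) \<in> USS G P D X"
proof -
  have Yc: "Y \<in> carrier G" using Y by simp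
  have "gconj G Y (inv Y \<otimes> Dp (gsup G P D Y)) \<in> USS G P D X"
    using USS_gconj_Dp[OF X Y] Yc by (simp add: gconj_inv_self_mult)
  moreover have "gconj G Y D \<in> USS G P D X"
    using USS_gconj_Dp[OF X Y, of 1] by simp
  ultimately show ?thesis
    using Yc by (simp add: iota_inv_eq USS_meet[OF X Y] inv_mult_Dp_gsup_in_P)
qed

text \<open>Descent: a non-minimal \<open>s\<close> has a proper nontrivial prefix with the same
  property.\<close>

lemma minimal_simple_below:
  assumes "s \<in> P" "s \<noteq> \<one>" "s \<preceq> D" "gconj G Y s \<in> USS G P D X"
  shows "\<exists>t. minimal_simple G P D X Y t \<and> t \<in> P \<and> t \<preceq> s"
  using assms
proof (induction "card (interval \<one> s)" arbitrary: s rule: less_induct)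
  case less
  show ?case
  proof (cases "minimal_simple G P D X Y s")
    case True
    then show ?thesis using less.prems by auto
  next
    case False
    then obtain t where t: "t \<in> P" "t \<preceq> s" "t \<noteq> \<one>" "t \<noteq> s" "gconj G Y t \<in> USS G P D X"
      using less.prems unfolding minimal_simple_def by (auto simp: simples_iff one_le_iff)
    moreover have "t \<preceq> D"
      using t less.prems by (meson le_trans P_carrier D_in_P)
    ultimately obtain u where "minimal_simple G P D X Y u" "u \<in> P" "u \<preceq> t"
      using less.hyps[of t] less.prems card_interval_less_right[of t s] by auto
    then show ?thesis
      using t less.prems by (meson le_trans P_carrier)
  qed
qed

lemma minimal_simpleD: "minimal_simple G P D X Y s \<Longrightarrow> s \<in> P \<and> s \<noteq> \<one> \<and> gconj G Y s \<in> USS G P D X"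
  by (simp add: minimal_simple_def simples_iff)

section \<open>Composition of paths\<close>

lemma oriented_path_append:
  "oriented_path G P D X Y (xs @ ys) Z \<longleftrightarrow>
    oriented_path G P D X Y xs (path_end G Y xs) \<and> oriented_path G P D X (path_end G Y xs) ys Z"
proof (induction xs arbitrary: Y)
  case Nil
  then show ?case
    by (cases ys) (auto simp: path_end_def is_arrow_def)
qed (simp add: path_end_def)

lemma oriented_path_end: "oriented_path G P D X Y xs Z \<Longrightarrow> path_end G Y xs = Z"
  by (induction xs arbitrary: Y) (auto simp: path_end_def)

lemma black_path_append:
  "black_path G P D Y (xs @ ys) \<longleftrightarrow> black_path G P D Y xs \<and> black_path G P D (path_end G Y xs) ys"
  by (induction xs arbitrary: Y) (auto simp: path_end_def)

lemma oriented_path_subset_P: "oriented_path G P D X Y xs Z \<Longrightarrow> set xs \<subseteq> P"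
  by (induction xs arbitrary: Y) (auto simp: is_arrow_def dest: minimal_simpleD)

lemma gprod_append_paths:
  assumes "oriented_path G P D X Y xs Z" "oriented_path G P D X Z ys W"
  shows "gprod G (xs @ ys) = gprod G xs \<otimes> gprod G ys"
  using assms by (intro gprod_append oriented_path_subset_P)

lemma oriented_path_trans:
  assumes "oriented_path G P D X Y xs Z" "oriented_path G P D X Z ys W"
  shows "oriented_path G P D X Y (xs @ ys) W"
  using assms oriented_path_append oriented_path_end by metis

text \<open>b c \<preceq> Y \<Delta>^(-p) \<preceq> Y b \<Delta>^(-p) = b Y^b \<Delta>^(-p), and
  \<open>b\<close> cancels. This is what keeps a path black after its first arrow
  \<open>b\<close>.\<close>

lemma iota_gconj_ge:
  assumes Y: "Y \<in> SSS G P D X" "gconj G Y b \<in> SSS G P D X"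
    and bc: "b \<in> P" "c \<in> P" "b \<otimes> c \<preceq> iota G P D Y"
  shows "c \<preceq> iota G P D (gconj G Y b)"
proof -
  define p where "p = ginf G P D Y"
  have Yc: "Y \<in> carrier G" using Y by simp
  have le: "b \<otimes> c \<preceq> Y \<otimes> Dp (- p)" "b \<otimes> c \<preceq> D"
    using bc Yc by (auto simp: iota_eq le_meet_iff p_def)
  have "Dp (- (- p)) \<otimes> b \<otimes> Dp (- p) \<in> P"
    using bc by (subst P_conj_Dp) auto
  then have "Y \<otimes> Dp (- p) \<preceq> Y \<otimes> Dp (- p) \<otimes> (Dp p \<otimes> b \<otimes> Dp (- p))"
    using Yc by (intro le_mult_P) auto
  also have "Y \<otimes> Dp (- p) \<otimes> (Dp p \<otimes> b \<otimes> Dp (- p)) = b \<otimes> (gconj G Y b \<otimes> Dp (- p))"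
    using Yc bc by (simp add: gconj_def m_assoc)
  finally have "b \<otimes> c \<preceq> b \<otimes> (gconj G Y b \<otimes> Dp (- p))"
    using le Yc bc by (meson le_trans P_carrier gconj_closed m_closed Dp_carrier)
  then have "c \<preceq> gconj G Y b \<otimes> Dp (- p)"
    using Yc bc by simp
  moreover have "c \<preceq> D"
  proof -
    \<comment> \<open>From b c u = \<Delta> with \<open>u\<close> positive follows c u
      (\<Delta>^(-1) b \<Delta>) = \<Delta>, so the inner factor \<open>c\<close> of \<Delta> is
      also a prefix.\<close>
    have "c \<otimes> (inv c \<otimes> inv b \<otimes> D \<otimes> (inv D \<otimes> b \<otimes> D)) = D"
      using bc by (simp add: m_assoc)
    moreover have "inv c \<otimes> inv b \<otimes> D \<in> P"
      using le(2) bc by (simp add: prefix_le_def inv_mult_group)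
    moreover have "inv D \<otimes> b \<otimes> D \<in> P"
      using bc by (simp add: P_conj_D)
    ultimately show ?thesis
      using le_mult_P[of c "inv c \<otimes> inv b \<otimes> D \<otimes> (inv D \<otimes> b \<otimes> D)"] bc by auto
  qed
  ultimately show ?thesis
    using Yc bc by (simp add: iota_eq SSS_ginf[OF Y] le_meet_iff p_def)
qed

text \<open>Remove a minimal simple prefix of \<beta> and recurse; \<open>iota_gconj_ge\<close>
  keeps the rest below \<iota>.\<close>

lemma black_path_below_iota:
  assumes X: "X \<in> carrier G" and "Y \<in> USS G P D X" "\<beta> \<in> P" "gconj G Y \<beta> \<in> USS G P D X"
    "\<beta> \<preceq> iota G P D Y"
  shows "\<exists>bs. oriented_path G P D X Y bs (gconj G Y \<beta>) \<and> black_path G P D Y bs \<and> gprod G bs = \<beta>"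
  using assms(2-)
proof (induction "card (interval \<one> \<beta>)" arbitrary: \<beta> Y rule: less_induct)
  case less
  note Y = less.prems(1) and \<beta> = less.prems(2-)
  have Yc: "Y \<in> carrier G" using Y by simp
  show ?case
  proof (cases "\<beta> = \<one>")
    case True
    then show ?thesis using Y Yc by (intro exI[of _ "[]"]) simp
  next
    case False
    have "\<beta> \<preceq> D"
      using \<beta> Yc by (simp add: iota_eq le_meet_iff)
    then obtain b where b: "minimal_simple G P D X Y b" "b \<in> P" "b \<preceq> \<beta>"
      using minimal_simple_below \<beta> False by blast
    define c where "c = inv b \<otimes> \<beta>"
    have c: "c \<in> P" "\<beta> = b \<otimes> c"
      using b \<beta> by (auto simp: c_def prefix_le_def)
    have bU: "gconj G Y b \<in> USS G P D X" "b \<noteq> \<one>"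
      using minimal_simpleD[OF b(1)] by auto
    have eq: "gconj G (gconj G Y b) c = gconj G Y \<beta>"
      using Yc b c by (simp add: gconj_mult)
    have "c \<preceq> iota G P D (gconj G Y b)"
      using iota_gconj_ge[OF USS_SSS[OF Y] USS_SSS[OF bU(1)]] b c \<beta> by simp
    moreover have "card (interval \<one> c) < card (interval \<one> \<beta>)"
      using card_interval_less_left b bU c by simp
    ultimately obtain bs where bs: "oriented_path G P D X (gconj G Y b) bs (gconj G Y \<beta>)"
        "black_path G P D (gconj G Y b) bs" "gprod G bs = c"
      using less.hyps[of c "gconj G Y b"] bU c \<beta> eq by auto
    have "b \<preceq> iota G P D Y"
      using b \<beta> Yc by (meson le_trans P_carrier iota_closed)
    then show ?thesis
      using bs b c Y by (intro exI[of _ "b # bs"]) (simp add: is_arrow_def)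
  qed
qed

text \<open>
  The hypothesis on \<open>\<alpha>\<close> says that the normal form of \<open>Y\<alpha>\<close> is the normal form of \<open>Y\<close> followed by
  that of \<open>\<alpha>\<close>. It survives the removal of the whole first factor \<open>\<alpha> \<and> \<Delta>\<close> of \<open>\<alpha>\<close>.
\<close>
lemma black_path_exists:
  assumes X: "X \<in> carrier G" and "Y \<in> USS G P D X" "glen G P D Y > 0" "\<alpha> \<in> P"
    "gconj G Y \<alpha> \<in> USS G P D X" "\<alpha> \<^bold>\<and> inv Y \<otimes> Dp (gsup G P D Y) = \<one>"
  shows "\<exists>bs. oriented_path G P D X Y bs (gconj G Y \<alpha>) \<and> black_path G P D Y bs \<and> gprod G bs = \<alpha>"
  using assms(2-)
proof (induction "card (interval \<one> \<alpha>)" arbitrary: \<alpha> Y rule: less_induct)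
  case less
  note Y = less.prems(1) and \<alpha> = less.prems(3-)
  have Yc: "Y \<in> carrier G" using Y by simp
  define p q where "p = ginf G P D Y" and "q = gsup G P D Y"
  have pq: "p < q" using less.prems(2) by (simp add: p_def q_def gsup_def)
  have meet_Y: "Y \<otimes> \<alpha> \<^bold>\<and> Dp q = Y"
    using \<alpha> Yc mult_meet[of \<alpha> "inv Y \<otimes> Dp q" Y] by (simp add: q_def)
  show ?case
  proof (cases "\<alpha> = \<one>")
    case True
    then show ?thesis using Y Yc by (intro exI[of _ "[]"]) simp
  next
    case False
    define \<beta> where "\<beta> = \<alpha> \<^bold>\<and> D"
    have \<beta>: "\<beta> \<in> P" "\<beta> \<noteq> \<one>" "\<beta> \<preceq> \<alpha>" "\<beta> \<preceq> D"
      using \<alpha> False meet_D_eq_one by (auto simp: \<beta>_def meet_in_P)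
    have \<beta>U: "gconj G Y \<beta> \<in> USS G P D X"
      using USS_meet[OF X Y] USS_gconj_Dp[OF X Y, of 1] \<alpha> by (simp add: \<beta>_def)
    have "\<beta> \<preceq> Y \<otimes> Dp (- p)"
    proof -
      have "\<beta> \<otimes> Dp p \<preceq> Y \<otimes> \<beta>"
        using \<beta>U SSS_gconj_iff[OF X USS_SSS[OF Y]] \<beta> USS_SSS by (auto simp: p_def)
      then have "\<beta> \<otimes> Dp p \<preceq> Y \<otimes> \<alpha>"
        using \<beta> \<alpha> Yc le_trans[of "\<beta> \<otimes> Dp p" "Y \<otimes> \<beta>" "Y \<otimes> \<alpha>"] by simp
      moreover have "\<beta> \<otimes> Dp p \<preceq> Dp q"
      proof -
        have "\<beta> \<otimes> Dp p \<preceq> D \<otimes> Dp p"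
          using \<beta> by (simp only: le_mult_Dp_iff P_carrier D_in_P)
        moreover have "D \<otimes> Dp p \<preceq> Dp q"
          using pq by simp
        ultimately show ?thesis
          using \<beta> by (meson le_trans P_carrier D_in_P m_closed Dp_carrier)
      qed
      ultimately have "\<beta> \<otimes> Dp p \<preceq> Y"
        using \<alpha> \<beta> Yc meet_greatest[of "Y \<otimes> \<alpha>" "Dp q" "\<beta> \<otimes> Dp p"] by (simp add: meet_Y)
      then have "\<beta> \<otimes> Dp p \<otimes> Dp (- p) \<preceq> Y \<otimes> Dp (- p)"
        using \<beta> Yc by (simp only: le_mult_Dp_iff P_carrier m_closed Dp_carrier)
      then show ?thesis
        using \<beta> by (simp add: m_assoc)
    qed
    then have "\<beta> \<preceq> iota G P D Y"
      using \<beta> Yc by (simp add: iota_eq meet_greatest p_def)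
    then obtain bs where bs: "oriented_path G P D X Y bs (gconj G Y \<beta>)" "black_path G P D Y bs"
        "gprod G bs = \<beta>"
      using black_path_below_iota[OF X Y] \<beta> \<beta>U by blast
    define W \<gamma> where "W = gconj G Y \<beta>" and "\<gamma> = inv \<beta> \<otimes> \<alpha>"
    have W: "W \<in> USS G P D X" "W \<in> carrier G" using \<beta>U by (simp_all add: W_def)
    have \<gamma>: "\<gamma> \<in> P" "\<alpha> = \<beta> \<otimes> \<gamma>"
      using \<beta> \<alpha> by (auto simp: \<gamma>_def prefix_le_def)
    have W\<gamma>: "gconj G W \<gamma> = gconj G Y \<alpha>"
      using \<beta> \<gamma> Yc by (simp add: W_def gconj_mult)
    have inf_sup: "gsup G P D W = q" "ginf G P D W = p"
      using SSS_gsup SSS_ginf USS_SSS Y W unfolding p_def q_def by metis+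
    \<comment> \<open>For a common prefix \<open>c\<close>, Y \<beta> c = \<beta> W c lies below
      \<beta> \<Delta>^q, hence below \<Delta>^(q+1), and also below Y \<alpha> \<Delta>. So Y
      \<beta> c \<preceq> (Y \<alpha> \<and> \<Delta>^q) \<Delta> = Y \<Delta>, and \<beta> c
      \<preceq> \<alpha> \<and> \<Delta> = \<beta> forces c = 1.\<close>
    have "\<gamma> \<^bold>\<and> inv W \<otimes> Dp (gsup G P D W) = \<one>"
    proof (rule meet_eq_oneI)
      fix c assume c: "c \<in> P" "c \<preceq> \<gamma>" "c \<preceq> inv W \<otimes> Dp (gsup G P D W)"
      have "W \<otimes> c \<preceq> W \<otimes> (inv W \<otimes> Dp q)"
        using c W by (simp only: le_mult_left_iff P_carrier m_closed inv_closed Dp_carrier inf_sup)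
      then have "\<beta> \<otimes> (W \<otimes> c) \<preceq> \<beta> \<otimes> Dp q"
        using \<beta> c W by simp
      moreover have "\<beta> \<otimes> Dp q \<preceq> D \<otimes> Dp q"
        using \<beta> by (simp only: le_mult_Dp_iff P_carrier D_in_P)
      ultimately have "\<beta> \<otimes> (W \<otimes> c) \<preceq> D \<otimes> Dp q"
        using \<beta> c W by (meson le_trans P_carrier D_in_P m_closed Dp_carrier)
      moreover have "\<beta> \<otimes> (W \<otimes> c) = Y \<otimes> (\<beta> \<otimes> c)"
        using \<beta> c Yc by (simp add: W_def gconj_def m_assoc)
      ultimately have 1: "Y \<otimes> (\<beta> \<otimes> c) \<preceq> Dp q \<otimes> D"
        by (simp add: add.commute)
      have \<beta>c: "\<beta> \<otimes> c \<preceq> \<alpha>"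
        using \<beta> \<gamma> c by simp
      have "Y \<otimes> (\<beta> \<otimes> c) \<preceq> Y \<otimes> \<alpha>"
        using \<beta>c \<beta> \<alpha> c Yc by simp
      moreover have "Y \<otimes> \<alpha> \<preceq> Y \<otimes> \<alpha> \<otimes> D"
        using \<alpha> Yc by blast
      ultimately have "Y \<otimes> (\<beta> \<otimes> c) \<preceq> Y \<otimes> \<alpha> \<otimes> D"
        using \<beta> \<alpha> c Yc by (meson le_trans P_carrier D_in_P m_closed)
      then have "Y \<otimes> (\<beta> \<otimes> c) \<preceq> (Y \<otimes> \<alpha> \<^bold>\<and> Dp q) \<otimes> D"
        using 1 \<beta> \<alpha> c Yc meet_mult_D[of "Y \<otimes> \<alpha>" "Dp q"]
          meet_greatest[of "Y \<otimes> \<alpha> \<otimes> D" "Dp q \<otimes> D" "Y \<otimes> (\<beta> \<otimes> c)"] by simp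
      then have "\<beta> \<otimes> c \<preceq> D"
        using \<beta> c Yc by (simp add: meet_Y)
      then have "\<beta> \<otimes> c \<preceq> \<beta>"
        using \<beta>c \<beta> c \<alpha> meet_greatest[of \<alpha> D "\<beta> \<otimes> c"] by (simp add: \<beta>_def[symmetric])
      then have "\<beta> \<otimes> c \<preceq> \<beta> \<otimes> \<one>"
        using \<beta> by simp
      then show "c = \<one>"
        using \<beta> c le_one by (simp only: le_mult_left_iff P_carrier one_closed)
    qed (use \<gamma> W inv_mult_Dp_gsup_in_P in auto)
    moreover have "card (interval \<one> \<gamma>) < card (interval \<one> \<alpha>)"
      using card_interval_less_left \<beta> \<gamma> by simp
    moreover have "glen G P D W > 0"
      using inf_sup pq by (simp add: gsup_def)
    ultimately obtain cs where cs: "oriented_path G P D X W cs (gconj G Y \<alpha>)" "black_path G P D W cs"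
        "gprod G cs = \<gamma>"
      using less.hyps[of \<gamma> W] W \<gamma>(1) \<alpha> unfolding W\<gamma> by blast
    show ?thesis
    proof (intro exI[of _ "bs @ cs"] conjI)
      show "oriented_path G P D X Y (bs @ cs) (gconj G Y \<alpha>)"
        using oriented_path_trans bs(1) cs(1) unfolding W_def by blast
      show "black_path G P D Y (bs @ cs)"
        using bs cs oriented_path_end[OF bs(1)] by (simp add: black_path_append W_def)
      show "gprod G (bs @ cs) = \<alpha>"
        using gprod_append_paths[OF bs(1) cs(1)[unfolded W_def]] bs cs \<gamma> by simp
    qed
  qed
qed

text \<open>Convexity keeps the conjugate of \<open>Y\<close> by \<alpha> \<and> \<iota>(Y^-1) in
  USS(X), so this meet, unless trivial, has a minimal simple prefix, which is the next grey
  arrow.\<close>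

lemma grey_prefix_exists:
  assumes X: "X \<in> carrier G" and "Y \<in> USS G P D X" "\<alpha> \<in> P" "gconj G Y \<alpha> \<in> USS G P D X"
  shows "\<exists>gs \<gamma> W. oriented_path G P D X Y gs W \<and> grey_path G P D Y gs \<and> \<gamma> \<in> P \<and>
    gprod G gs \<otimes> \<gamma> = \<alpha> \<and> gconj G W \<gamma> = gconj G Y \<alpha> \<and> \<gamma> \<^bold>\<and> iota G P D (inv W) = \<one>"
  using assms(2-)
proof (induction "card (interval \<one> \<alpha>)" arbitrary: \<alpha> Y rule: less_induct)
  case less
  note Y = less.prems(1) and \<alpha> = less.prems(2-)
  have Yc: "Y \<in> carrier G" using Y by simp
  define \<beta> where "\<beta> = \<alpha> \<^bold>\<and> iota G P D (inv Y)"
  show ?case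
  proof (cases "\<beta> = \<one>")
    case True
    then show ?thesis
      using Y Yc \<alpha> by (intro exI[of _ "[]"] exI[of _ \<alpha>] exI[of _ Y]) (simp add: \<beta>_def)
  next
    case False
    have \<beta>: "\<beta> \<in> P" "\<beta> \<preceq> \<alpha>" "\<beta> \<preceq> iota G P D (inv Y)"
      using \<alpha> Yc iota_inv_in_P by (auto simp: \<beta>_def meet_in_P)
    have "iota G P D (inv Y) \<preceq> D"
      using Yc by (simp add: iota_inv_eq)
    then have "\<beta> \<preceq> D"
      using \<beta> Yc by (meson le_trans P_carrier D_in_P inv_closed iota_closed)
    moreover have "gconj G Y \<beta> \<in> USS G P D X"
      unfolding \<beta>_def
      using USS_meet[OF X Y \<alpha> iota_inv_in_P[OF Yc] USS_gconj_iota_inv[OF X Y]] .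
    ultimately obtain g where g: "minimal_simple G P D X Y g" "g \<in> P" "g \<preceq> \<beta>"
      using minimal_simple_below \<beta> False by blast
    have gle: "g \<preceq> \<alpha>" "g \<preceq> iota G P D (inv Y)"
      using g \<beta> \<alpha> Yc by (meson le_trans P_carrier inv_closed iota_closed)+
    define c where "c = inv g \<otimes> \<alpha>"
    have c: "c \<in> P" "\<alpha> = g \<otimes> c"
      using g gle \<alpha> by (auto simp: c_def prefix_le_def)
    have gU: "gconj G Y g \<in> USS G P D X" "g \<noteq> \<one>"
      using minimal_simpleD[OF g(1)] by auto
    have eq: "gconj G (gconj G Y g) c = gconj G Y \<alpha>"
      using Yc g c by (simp add: gconj_mult)
    have "card (interval \<one> c) < card (interval \<one> \<alpha>)"
      using card_interval_less_left g gU c by simp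
    then obtain gs \<gamma> W where gs: "oriented_path G P D X (gconj G Y g) gs W"
        "grey_path G P D (gconj G Y g) gs" "\<gamma> \<in> P" "gprod G gs \<otimes> \<gamma> = c"
        "gconj G W \<gamma> = gconj G Y \<alpha>" "\<gamma> \<^bold>\<and> iota G P D (inv W) = \<one>"
      using less.hyps[of c "gconj G Y g"] gU c(1) \<alpha> unfolding eq by blast
    have "gprod G gs \<in> P"
      using gs(1) oriented_path_subset_P by blast
    then have "gprod G (g # gs) \<otimes> \<gamma> = \<alpha>"
      using gs c g by (simp add: m_assoc)
    then show ?thesis
      using gs g gle Y
      by (intro exI[of _ "g # gs"] exI[of _ \<gamma>] exI[of _ W]) (simp add: is_arrow_def)
  qed
qed

theorem grey_black_path_exists:
  assumes X: "X \<in> carrier G" and Y: "Y \<in> USS G P D X" "glen G P D Y > 0"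
    and \<alpha>: "\<alpha> \<in> P" "gconj G Y \<alpha> \<in> USS G P D X"
  shows "\<exists>gs bs. oriented_path G P D X Y (gs @ bs) (gconj G Y \<alpha>) \<and> grey_path G P D Y gs \<and>
    black_path G P D (path_end G Y gs) bs \<and> gprod G (gs @ bs) = \<alpha>"
proof -
  obtain gs \<gamma> W where gs: "oriented_path G P D X Y gs W" "grey_path G P D Y gs" "\<gamma> \<in> P"
      "gprod G gs \<otimes> \<gamma> = \<alpha>" "gconj G W \<gamma> = gconj G Y \<alpha>" "\<gamma> \<^bold>\<and> iota G P D (inv W) = \<one>"
    using grey_prefix_exists[OF X Y(1) \<alpha>] by blast
  have W: "W \<in> USS G P D X"
    using gs(1) by (induction gs arbitrary: Y) auto
  have Wc: "W \<in> carrier G" using W by simp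
  have "glen G P D W = glen G P D Y"
    using SSS_gsup[OF USS_SSS USS_SSS, OF Y(1) W] SSS_ginf[OF USS_SSS USS_SSS, OF Y(1) W]
    by (simp add: gsup_def)
  \<comment> \<open>The grey part only ensures a trivial meet with \<iota>(W^-1) = W^-1 \<Delta>^q
    \<and> \<Delta>; \<open>meet_D_eq_one\<close> removes the \<Delta>.\<close>
  moreover have "\<gamma> \<^bold>\<and> inv W \<otimes> Dp (gsup G P D W) = \<one>"
  proof -
    define e where "e = \<gamma> \<^bold>\<and> inv W \<otimes> Dp (gsup G P D W)"
    have e: "e \<in> P"
      using gs(3) Wc by (simp add: e_def meet_in_P inv_mult_Dp_gsup_in_P)
    have "e \<^bold>\<and> D \<preceq> \<gamma> \<^bold>\<and> iota G P D (inv W)"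
      using gs(3) Wc e by (auto simp: e_def iota_inv_eq le_meet_iff intro: meet_coboundedI1)
    then have "e \<^bold>\<and> D = \<one>"
      using le_one e by (simp add: gs(6) meet_in_P)
    then show ?thesis
      using meet_D_eq_one e unfolding e_def by blast
  qed
  ultimately obtain bs where bs: "oriented_path G P D X W bs (gconj G Y \<alpha>)" "black_path G P D W bs"
      "gprod G bs = \<gamma>"
    using black_path_exists[OF X W _ gs(3)] Y(2) \<alpha>(2) by (auto simp: gs(5))
  show ?thesis
  proof (rule exI[of _ gs], rule exI[of _ bs], intro conjI)
    show "oriented_path G P D X Y (gs @ bs) (gconj G Y \<alpha>)"
      using oriented_path_trans gs(1) bs(1) by blast
    show "grey_path G P D Y gs" by fact
    show "black_path G P D (path_end G Y gs) bs"
      using bs oriented_path_end[OF gs(1)] by simp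
    show "gprod G (gs @ bs) = \<alpha>"
      using gprod_append_paths[OF gs(1) bs(1)] gs bs by simp
  qed
qed

section \<open>Existence of positive conjugators\<close>

lemma Dp_period:
  assumes "Z \<in> carrier G"
  shows "\<exists>n>0. gconj G Z (Dp (int n)) = Z"
proof -
  define I where "I = interval (Dp (ginf G P D Z)) (Dp (gsup G P D Z))"
  have "Dp (ginf G P D Z) \<otimes> Dp k \<preceq> Z \<otimes> Dp k" "Z \<otimes> Dp k \<preceq> Dp (gsup G P D Z) \<otimes> Dp k" for k
    using assms by (simp_all only: le_mult_Dp_iff Dp_carrier) (simp_all add: Dp_le_iff_ginf le_Dp_iff_gsup)
  \<comment> \<open>Conjugates by powers of \<Delta> keep the bounds of \<open>Z\<close>, so they
    lie in one finite interval and must repeat.\<close>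
  then have "gconj G Z (Dp k) \<in> I" for k
    using assms by (simp add: I_def interval_def Dp_le_gconj_iff gconj_le_Dp_iff add.commute)
  then have "finite (range (\<lambda>n::nat. gconj G Z (Dp (int n))))"
    using finite_interval finite_subset[of _ I] unfolding I_def by (metis Dp_carrier image_subsetI)
  then have "\<not> inj (\<lambda>n::nat. gconj G Z (Dp (int n)))"
    using finite_imageD infinite_UNIV_nat by blast
  then obtain i j :: nat where ij: "i < j" "gconj G Z (Dp (int i)) = gconj G Z (Dp (int j))"
    unfolding inj_def by (metis linorder_neqE_nat)
  have "gconj G (gconj G Z (Dp (int i))) (Dp (- int i)) = gconj G (gconj G Z (Dp (int j))) (Dp (- int i))"
    using ij by simp
  then have "Z = gconj G Z (Dp (int (j - i)))"
    using assms ij(1) by (simp add: of_nat_diff flip: gconj_mult)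
  then show ?thesis
    using ij(1) by (intro exI[of _ "j - i"]) auto
qed

text \<open>Some positive power of \<Delta> commutes with \<open>Z\<close>; a conjugator times a
  large multiple of that power becomes positive and still ends at \<open>Z\<close>.\<close>

lemma USS_positive_conjugator:
  assumes X: "X \<in> carrier G" and Y: "Y \<in> USS G P D X" and Z: "Z \<in> USS G P D X"
  shows "\<exists>\<alpha>\<in>P. Z = gconj G Y \<alpha>"
proof -
  obtain a b where a: "a \<in> carrier G" "Y = gconj G X a" and b: "b \<in> carrier G" "Z = gconj G X b"
    using Y Z unfolding USS_def SSS_def conjugate_def by blast
  define c where "c = inv a \<otimes> b"
  have c: "c \<in> carrier G" "Z = gconj G Y c"
    using a b X by (auto simp: c_def gconj_inv_mult)
  obtain n where n: "n > 0" "gconj G Z (Dp (int n)) = Z"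
    using Dp_period Z USS_carrier by blast
  have period: "gconj G Z (Dp (int (n * m))) = Z" for m
  proof (induction m)
    case (Suc m)
    have "gconj G Z (Dp (int (n * m)) \<otimes> Dp (int n)) = Z"
      using Suc n Z by (simp only: gconj_mult USS_carrier Dp_carrier)
    then show ?case by (simp add: algebra_simps)
  qed (use Z in simp)
  obtain k where k: "Dp k \<preceq> c" using Dp_lower_bound c by blast
  \<comment> \<open>As n \<ge> 1, the exponent n m is at least -k, which lifts the lower bound
    \<Delta>^k of \<open>c\<close> to 1 or above.\<close>
  define m where "m = nat \<bar>k\<bar>"
  have "- k \<le> int (n * m)"
  proof -
    have "\<bar>k\<bar> * 1 \<le> \<bar>k\<bar> * int n"
      using n by (intro mult_left_mono) auto
    then show ?thesis by (simp add: m_def mult.commute)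
  qed
  then have "Dp 0 \<preceq> Dp (k + int (n * m))"
    by (simp only: Dp_le_iff)
  moreover have "Dp k \<otimes> Dp (int (n * m)) \<preceq> c \<otimes> Dp (int (n * m))"
    using k c by (simp only: le_mult_Dp_iff Dp_carrier)
  ultimately have "\<one> \<preceq> c \<otimes> Dp (int (n * m))"
    using c le_trans[of \<one> "Dp (k + int (n * m))" "c \<otimes> Dp (int (n * m))"] by simp
  then have "c \<otimes> Dp (int (n * m)) \<in> P"
    using c one_le_iff by simp
  moreover have "Z = gconj G Y (c \<otimes> Dp (int (n * m)))"
    using c Y period by (simp add: gconj_mult)
  ultimately show ?thesis by blast
qed

end

theorem mainTheorem9:
  fixes G :: "('a, 'b) monoid_scheme" and P :: "'a set" and D :: 'a and X Y Z :: 'a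
  assumes "garside_group G P D"
    and "X \<in> carrier G"
    and "Y \<in> USS G P D X" and "Z \<in> USS G P D X"
    and "glen G P D Y > 0"
  shows "(\<exists>gs bs. oriented_path G P D X Y (gs @ bs) Z \<and> grey_path G P D Y gs \<and>
              black_path G P D (path_end G Y gs) bs)
       \<and> (\<forall>\<alpha>\<in>P. Z = gconj G Y \<alpha> \<longrightarrow>
            (\<exists>gs bs. oriented_path G P D X Y (gs @ bs) Z \<and> grey_path G P D Y gs \<and>
              black_path G P D (path_end G Y gs) bs \<and> gprod G (gs @ bs) = \<alpha>))"
proof (cases "D = \<one>\<^bsub>G\<^esub>")
  case True
  \<comment> \<open>\<open>G\<close> is trivial, no normal form exists, and \<open>glen\<close>, \<open>iota\<close> are junk values.\<close>
  interpret group G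
    using assms(1) by (simp add: garside_group_def)
  have P: "P \<subseteq> carrier G" "\<And>x. x \<in> P \<Longrightarrow> inv\<^bsub>G\<^esub> x \<in> P \<Longrightarrow> x = \<one>\<^bsub>G\<^esub>"
    and gen: "generate G (simples G P D) = carrier G"
    using assms(1) unfolding garside_group_def by blast+
  \<comment> \<open>1 \<preceq> s \<preceq> \<Delta> = 1 makes both \<open>s\<close> and its inverse
    positive.\<close>
  have "simples G P D \<subseteq> {\<one>\<^bsub>G\<^esub>}"
  proof
    fix s assume "s \<in> simples G P D"
    then have "s \<in> P" "inv\<^bsub>G\<^esub> s \<in> P"
      using True by (auto simp: simples_def prefix_le_def)
    then show "s \<in> {\<one>\<^bsub>G\<^esub>}" using P(2) by blast
  qed
  then have "carrier G \<subseteq> {\<one>\<^bsub>G\<^esub>}"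
    using mono_generate[of "simples G P D" "{\<one>\<^bsub>G\<^esub>}"] generate_one gen by simp
  moreover have "Y \<in> carrier G" "Z \<in> carrier G"
    using assms by (simp_all add: USS_def SSS_def)
  ultimately have "Z = Y" "\<And>\<alpha>. \<alpha> \<in> P \<Longrightarrow> \<alpha> = \<one>\<^bsub>G\<^esub>"
    using P(1) by auto
  then show ?thesis
    using assms(3) by (auto intro!: exI[of _ "[]"] simp: gprod_def)
next
  case False
  interpret garside G P D
    using assms(1) False by (simp add: garside_def garside_axioms_def garside_group_def)
  have path: "\<exists>gs bs. oriented_path G P D X Y (gs @ bs) Z \<and> grey_path G P D Y gs \<and>
      black_path G P D (path_end G Y gs) bs \<and> gprod G (gs @ bs) = \<alpha>"
    if "\<alpha> \<in> P" "Z = gconj G Y \<alpha>" for \<alpha>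
    using grey_black_path_exists[OF assms(2,3,5) that(1)] assms(4) that(2) by simp
  \<comment> \<open>The first claim is the second one for some positive conjugator.\<close>
  moreover obtain \<alpha> where "\<alpha> \<in> P" "Z = gconj G Y \<alpha>"
    using USS_positive_conjugator[OF assms(2-4)] by blast
  ultimately show ?thesis by blast
qed

end
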